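(* Let $K$ be a $J$-Hermitian kernel on $\mathbb{R}$ satisfying the following. (1) $K$ is the integral kernel of a bounded linear operator (also denoted $K$) on $L^2(\mathbb{R})$ such that $P_+KP_+$ and $P_-KP_-$ are non-negative; for all bounded subsets $\Delta_1\subset\mathbb{R}_+$, $\Delta_2\subset\mathbb{R}_-$, the operators $\chi_{\Delta_i}K\chi_{\Delta_i}$ ($i=1,2$) are trace-class and $\chi_{\Delta_2}K\chi_{\Delta_1}$ is Hilbert–Schmidt; and $\widehat K:=\mathrm{sgn}\cdot K+\chi_{\mathbb{R}_-}$ is an orthogonal projection on $L^2(\mathbb{R},dx)$. (2) For every $R>0$, $\int_{|x|\le R}K(x,x)\,dx<\infty$; and for some fixed $M>0$ there is a non-negative $\Phi\in L^1(\mathbb{R},dt)$ with $\int_{|t|\ge R}\Phi(t)\,dt=O(R^{-1})$ as $R\to\infty$ such that $|K(x,y)|^2\le\Phi(x-y)$ whenever $|x|\ge M$ and $|y|\ge M$. Then for any bounded Borel subset $B\subset\mathbb{R}$ there exists a measurable function $N_B^{out}:\mathrm{Conf}(\mathbb{R})\to\mathbb{Z}$ such that for $\mathbb{P}_K$-almost every $X\in\mathrm{Conf}(\mathbb{R})$, $$\#(B\cap X\cap\mathbb{R}_+)-\#(B\cap X\cap\mathbb{R}_-)=N_B^{out}(X\setminus B).$$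
   Context: $\mathbb{R}_+$, $\mathbb{R}_-$ are the open positive and negative semi-axes, $\mathbb{R}^*=\mathbb{R}_+\sqcup\mathbb{R}_-$; $P_\pm$ are the orthogonal projections of $L^2(\mathbb{R})$ onto $L^2(\mathbb{R}_\pm)$; bounded functions are identified with multiplication operators. A kernel $K$ is $J$-Hermitian if it induces a bounded operator on $L^2(\mathbb{R})$ and $K(x,y)=\mathrm{sgn}(x)\mathrm{sgn}(y)\overline{K(y,x)}$ for $x,y\in\mathbb{R}^*$. $\mathrm{Conf}(\mathbb{R})$ is the set of locally finite subsets of $\mathbb{R}$ with the Borel structure generated by the maps $X\mapsto\#(X\cap B)$, $B$ bounded Borel. A probability measure on $\mathrm{Conf}(\mathbb{R})$ is determinantal with correlation kernel $K$ if for all $k\ge1$ and disjoint bounded Borel $D_1,\dots,D_k$, $\mathbb{E}\prod_{i}\#(X\cap D_i)=\int_{D_1\times\cdots\times D_k}\det(K(x_i,x_j))_{1\le i,j\le k}\,dx_1\cdots dx_k$. By a theorem of Lytvynov, a kernel $K$ satisfying (1) is the correlation kernel of a determinantal point process on $\mathbb{R}$, denoted $\mathbb{P}_K$ (as usual the integral kernel is chosen so that its diagonal values $K(x,x)$ give the local traces). *)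

theory Defs
  imports "HOL-Probability.Probability" "Jordan_Normal_Form.Determinant"
begin

text \<open>
  Elements of the Hilbert space are represented by square-integrable Borel functions, and equality
  of elements is equality almost everywhere; operators act on representatives.
\<close>

definition L2 :: "(real \<Rightarrow> complex) set" where
  "L2 = {f \<in> borel_measurable lborel. integrable lborel (\<lambda>x. (cmod (f x))\<^sup>2)}"

definition L2_inner :: "(real \<Rightarrow> complex) \<Rightarrow> (real \<Rightarrow> complex) \<Rightarrow> complex" where
  "L2_inner f g = (LINT x|lborel. f x * cnj (g x))"

definition L2_norm :: "(real \<Rightarrow> complex) \<Rightarrow> real" where
  "L2_norm f = sqrt (LINT x|lborel. (cmod (f x))\<^sup>2)"

type_synonym L2_operator = "(real \<Rightarrow> complex) \<Rightarrow> (real \<Rightarrow> complex)"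

text \<open>
  Compatibility with equality almost everywhere is not listed: it follows from additivity and
  boundedness.
\<close>

definition L2_bounded_linear :: "L2_operator \<Rightarrow> bool" where
  "L2_bounded_linear T \<longleftrightarrow>
     (\<forall>f\<in>L2. T f \<in> L2) \<and>
     (\<forall>f\<in>L2. \<forall>g\<in>L2. AE x in lborel. T (\<lambda>y. f y + g y) x = T f x + T g x) \<and>
     (\<forall>c. \<forall>f\<in>L2. AE x in lborel. T (\<lambda>y. c * f y) x = c * T f x) \<and>
     (\<exists>C. \<forall>f\<in>L2. L2_norm (T f) \<le> C * L2_norm f)"

definition L2_nonneg :: "L2_operator \<Rightarrow> bool" where
  "L2_nonneg T \<longleftrightarrow> L2_bounded_linear T \<and> (\<forall>f\<in>L2. L2_inner (T f) f \<in> \<real>\<^sub>\<ge>\<^sub>0)"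

definition L2_adjoint :: "L2_operator \<Rightarrow> L2_operator \<Rightarrow> bool" where
  "L2_adjoint T T' \<longleftrightarrow> L2_bounded_linear T \<and> L2_bounded_linear T' \<and>
     (\<forall>f\<in>L2. \<forall>g\<in>L2. L2_inner (T f) g = L2_inner f (T' g))"

definition L2_orthogonal_projection :: "L2_operator \<Rightarrow> bool" where
  "L2_orthogonal_projection T \<longleftrightarrow> L2_adjoint T T \<and> (\<forall>f\<in>L2. AE x in lborel. T (T f) x = T f x)"

definition L2_orthonormal_basis :: "(nat \<Rightarrow> real \<Rightarrow> complex) \<Rightarrow> bool" where
  "L2_orthonormal_basis e \<longleftrightarrow>
     (\<forall>n. e n \<in> L2) \<and>
     (\<forall>m n. L2_inner (e m) (e n) = (if m = n then 1 else 0)) \<and>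
     (\<forall>f\<in>L2. (\<forall>n. L2_inner f (e n) = 0) \<longrightarrow> (AE x in lborel. f x = 0))"

definition L2_hilbert_schmidt :: "L2_operator \<Rightarrow> bool" where
  "L2_hilbert_schmidt T \<longleftrightarrow> L2_bounded_linear T \<and>
     (\<exists>e. L2_orthonormal_basis e \<and> summable (\<lambda>n. (L2_norm (T (e n)))\<^sup>2))"

text \<open>\<open>L2_absolute_value T S\<close> says that \<open>S\<close> is the non-negative square root of \<open>T\<^sup>* T\<close>.\<close>

definition L2_absolute_value :: "L2_operator \<Rightarrow> L2_operator \<Rightarrow> bool" where
  "L2_absolute_value T S \<longleftrightarrow> L2_nonneg S \<and>
     (\<exists>T'. L2_adjoint T T' \<and> (\<forall>f\<in>L2. AE x in lborel. S (S f) x = T' (T f) x))"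

definition L2_trace_class :: "L2_operator \<Rightarrow> bool" where
  "L2_trace_class T \<longleftrightarrow> L2_bounded_linear T \<and>
     (\<exists>S. L2_absolute_value T S \<and>
       (\<exists>e. L2_orthonormal_basis e \<and> summable (\<lambda>n. L2_inner (S (e n)) (e n))))"

definition L2_has_trace :: "L2_operator \<Rightarrow> complex \<Rightarrow> bool" where
  "L2_has_trace T t \<longleftrightarrow>
     (\<forall>e. L2_orthonormal_basis e \<longrightarrow> (\<lambda>n. L2_inner (T (e n)) (e n)) sums t)"

definition mult_op :: "(real \<Rightarrow> complex) \<Rightarrow> L2_operator" where
  "mult_op \<phi> f = (\<lambda>x. \<phi> x * f x)"

text \<open>
  \<open>compress A T B\<close> is the operator \<open>\<chi>\<^sub>A T \<chi>\<^sub>B\<close>.  As multiplication by the indicator function of a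
  half-line is the orthogonal projection onto the functions supported there,
  \<open>P\<^sub>+ K P\<^sub>+\<close> is \<open>compress {0<..} K {0<..}\<close>.
\<close>

definition compress :: "real set \<Rightarrow> L2_operator \<Rightarrow> real set \<Rightarrow> L2_operator" where
  "compress A T B = mult_op (indicator A) \<circ> T \<circ> mult_op (indicator B)"

definition hat_op :: "L2_operator \<Rightarrow> L2_operator" where
  "hat_op T f =
     (\<lambda>x. mult_op (\<lambda>x. complex_of_real (sgn x)) (T f) x + mult_op (indicator {..<0}) f x)"

definition integral_kernel :: "(real \<Rightarrow> real \<Rightarrow> complex) \<Rightarrow> L2_operator \<Rightarrow> bool" where
  "integral_kernel K T \<longleftrightarrow>
     case_prod K \<in> borel_measurable (lborel \<Otimes>\<^sub>M lborel) \<and> L2_bounded_linear T \<and>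
     (\<forall>f\<in>L2. AE x in lborel.
        integrable lborel (\<lambda>y. K x y * f y) \<and> T f x = (LINT y|lborel. K x y * f y))"

definition J_hermitian :: "(real \<Rightarrow> real \<Rightarrow> complex) \<Rightarrow> bool" where
  "J_hermitian K \<longleftrightarrow> (\<exists>T. integral_kernel K T) \<and>
     (\<forall>x y. x \<noteq> 0 \<longrightarrow> y \<noteq> 0 \<longrightarrow> K x y = complex_of_real (sgn x * sgn y) * cnj (K y x))"

text \<open>
  A kernel is determined by its operator only up to null sets, so its diagonal has to be normalised
  separately: it must reproduce the traces of the operator compressed to bounded sets on either
  side of the origin.
\<close>

definition diagonal_gives_local_traces ::
    "(real \<Rightarrow> real \<Rightarrow> complex) \<Rightarrow> L2_operator \<Rightarrow> bool" where
  "diagonal_gives_local_traces K T \<longleftrightarrow>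
     (\<forall>\<Delta>\<in>sets borel. bounded \<Delta> \<and> (\<Delta> \<subseteq> {0<..} \<or> \<Delta> \<subseteq> {..<0}) \<longrightarrow>
        set_integrable lborel \<Delta> (\<lambda>x. K x x) \<and>
        L2_has_trace (compress \<Delta> T \<Delta>) (LINT x:\<Delta>|lborel. K x x))"

definition Conf :: "real set set" where
  "Conf = {X. \<forall>B. bounded B \<longrightarrow> finite (X \<inter> B)}"

definition conf_space :: "real set measure" where
  "conf_space =
     sigma Conf {{X \<in> Conf. card (X \<inter> B) = n} | B n. bounded B \<and> B \<in> sets borel}"

definition determinantal :: "(real \<Rightarrow> real \<Rightarrow> complex) \<Rightarrow> real set measure \<Rightarrow> bool" where
  "determinantal K P \<longleftrightarrow> prob_space P \<and> sets P = sets conf_space \<and>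
     (\<forall>k\<ge>1. \<forall>D :: nat \<Rightarrow> real set.
        (\<forall>i<k. bounded (D i) \<and> D i \<in> sets borel) \<and> disjoint_family_on D {..<k} \<longrightarrow>
        integrable P (\<lambda>X. \<Prod>i<k. real (card (X \<inter> D i))) \<and>
        set_integrable (\<Pi>\<^sub>M i\<in>{..<k}. lborel) (\<Pi>\<^sub>E i\<in>{..<k}. D i)
          (\<lambda>x. Determinant.det (Matrix.mat k k (\<lambda>(i, j). K (x i) (x j)))) \<and>
        complex_of_real (LINT X|P. (\<Prod>i<k. real (card (X \<inter> D i)))) =
          (LINT x:(\<Pi>\<^sub>E i\<in>{..<k}. D i)|(\<Pi>\<^sub>M i\<in>{..<k}. lborel).
             Determinant.det (Matrix.mat k k (\<lambda>(i, j). K (x i) (x j)))))"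

end

theory Submission
  imports Defs
begin

text \<open>
  The argument is the one of Ghosh and Peres.  Call
  \<open>Z\<^sub>i = #(X \<inter> (0, i]) - #(X \<inter> [-i, 0))\<close> the charge of the window \<open>[-i, i]\<close>.  If \<open>i\<close> is so large that
  the window contains \<open>B\<close>, then \<open>Z\<^sub>i(X)\<close> differs from \<open>Z\<^sub>i(X - B)\<close> exactly by the signed count in
  \<open>B\<close>, and the same holds for every weighted average \<open>Y\<close> of such charges.  Hence, if there are
  averages \<open>Y\<^sub>s\<close> with \<open>Var Y\<^sub>s\<close> summable, then \<open>Y\<^sub>s - E Y\<^sub>s \<rightarrow> 0\<close> almost surely, and the signed count
  in \<open>B\<close> is the limit of \<open>E Y\<^sub>s - Y\<^sub>s(X - B)\<close>, a function of \<open>X - B\<close> (\<open>charge_rigidity\<close>).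

  Let \<open>\<rho>\<close> be the measure with density \<open>|K(x, y)|\<^sup>2\<close> on the plane.  Two facts bound the covariances of
  the charges.  The signs in the definition of a \<open>J\<close>-Hermitian kernel turn the correlation term
  \<open>K(x, y) K(y, x)\<close> into \<open>sgn x sgn y |K(x, y)|\<^sup>2\<close>, and the same signs occur in the charges, so that
  for \<open>i \<le> j\<close> the covariance of \<open>Z\<^sub>i\<close> and \<open>Z\<^sub>j\<close> is the mean number of points in \<open>[-i, i]\<close> minus
  \<open>\<rho>([-i, i] \<times> [-j, j])\<close>.  The projection property makes the mean number of points in a bounded
  set \<open>D\<close> equal to \<open>\<rho>(D \<times> \<real>)\<close> (\<open>trace_eq_kernel_measure\<close>): if \<open>e\<^sub>n\<close> is an orthonormal basis, the
  local trace is \<open>\<Sum>\<^sub>n \<parallel>K \<chi>\<^sub>D e\<^sub>n\<parallel>\<^sup>2\<close>, and Parseval's identity for the functions \<open>K(x, \<cdot>) \<chi>\<^sub>D\<close> evaluates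
  this sum.  What remains of the covariance is the leakage \<open>\<rho>([-i, i] \<times> {|y| > j})\<close>
  (\<open>covariance_le_leakage\<close>).

  The leakage tends to \<open>0\<close> as \<open>j \<rightarrow> \<infinity>\<close> for fixed \<open>i\<close>, because \<open>\<rho>([-i, i] \<times> \<real>)\<close> is finite.  The tail
  bound on \<open>\<Phi>\<close> limits the leakage to \<open>b + c \<Sum>\<^sub>u\<^sub>\<le>\<^sub>i 1 / (1 + j - u)\<close> for some constants \<open>b\<close> and \<open>c\<close>
  (\<open>leakage_bound\<close>).  This bound grows like \<open>log i\<close> for \<open>i = j\<close>, but it is bounded on average: the uniform
  average of the charges over \<open>n \<le> i < 2 n\<close> has a variance bounded independently of \<open>n\<close>
  (\<open>uniform_average_bounded\<close>).  Finally, bounded variances can be improved to arbitrarily small ones: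
  the mean of two averages of variance at most \<open>c\<close>, the second one taken over windows so large that
  the two are nearly uncorrelated, has variance at most \<open>3 c / 4\<close> (\<open>averaging_halving\<close>).
\<close>

section \<open>Square-integrable functions and Parseval's identity\<close>

lemma borel_measurable_cnj [measurable (raw)]:
  "f \<in> borel_measurable M \<Longrightarrow> (\<lambda>x. cnj (f x)) \<in> borel_measurable M"
  by (rule borel_measurable_continuous_on[OF continuous_on_cnj[OF continuous_on_id]])

lemma L2_measurable [measurable_dest]: "f \<in> L2 \<Longrightarrow> f \<in> borel_measurable borel"
  by (simp add: L2_def)

lemma L2_integrable_square: "f \<in> L2 \<Longrightarrow> integrable lborel (\<lambda>x. (cmod (f x))\<^sup>2)"
  by (simp add: L2_def)

lemma L2_norm_square: "(L2_norm f)\<^sup>2 = (LINT x|lborel. (cmod (f x))\<^sup>2)"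
  by (simp add: L2_norm_def)

lemma L2_norm_nonneg: "L2_norm f \<ge> 0"
  by (simp add: L2_norm_def)

lemma L2_nn_integral:
  "f \<in> L2 \<Longrightarrow> (\<integral>\<^sup>+x. ennreal ((cmod (f x))\<^sup>2) \<partial>lborel) = ennreal ((L2_norm f)\<^sup>2)"
  by (simp add: L2_norm_square nn_integral_eq_integral L2_integrable_square)

lemma L2I:
  assumes [measurable]: "f \<in> borel_measurable borel"
    and "(\<integral>\<^sup>+x. ennreal ((cmod (f x))\<^sup>2) \<partial>lborel) < \<infinity>"
  shows "f \<in> L2"
  using assms by (auto simp: L2_def intro!: integrableI_bounded)

lemma L2_dominated:
  assumes "f \<in> L2" and [measurable]: "g \<in> borel_measurable borel"
    and "AE x in lborel. cmod (g x) \<le> c * cmod (f x)"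
  shows "g \<in> L2"
proof -
  have "integrable lborel (\<lambda>x. c\<^sup>2 * (cmod (f x))\<^sup>2)"
    using L2_integrable_square[OF assms(1)] by simp
  then have "integrable lborel (\<lambda>x. (cmod (g x))\<^sup>2)"
  proof (rule Bochner_Integration.integrable_bound)
    show "AE x in lborel. norm ((cmod (g x))\<^sup>2) \<le> norm (c\<^sup>2 * (cmod (f x))\<^sup>2)"
      using assms(3)
    proof eventually_elim
      case (elim x)
      then have "(cmod (g x))\<^sup>2 \<le> (c * cmod (f x))\<^sup>2" by (intro power_mono) auto
      then show ?case by (simp add: power_mult_distrib)
    qed
  qed simp
  then show ?thesis by (simp add: L2_def)
qed

lemma L2_mult_bounded:
  assumes "f \<in> L2" and [measurable]: "h \<in> borel_measurable borel" and "\<And>x. cmod (h x) \<le> c"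
  shows "(\<lambda>x. h x * f x) \<in> L2"
proof (rule L2_dominated[OF assms(1)])
  show "AE x in lborel. cmod (h x * f x) \<le> c * cmod (f x)"
    using assms(3) by (auto simp: norm_mult intro!: mult_right_mono)
qed (use assms(1) in measurable)

lemma L2_scale: "f \<in> L2 \<Longrightarrow> (\<lambda>x. c * f x) \<in> L2"
  using L2_mult_bounded[of f "\<lambda>_. c" "cmod c"] by simp

lemma L2_add:
  assumes "f \<in> L2" "g \<in> L2"
  shows "(\<lambda>x. f x + g x) \<in> L2"
proof -
  have [measurable]: "f \<in> borel_measurable borel" "g \<in> borel_measurable borel"
    using assms by (auto dest: L2_measurable)
  have "integrable lborel (\<lambda>x. 2 * (cmod (f x))\<^sup>2 + 2 * (cmod (g x))\<^sup>2)"
    by (intro Bochner_Integration.integrable_add integrable_mult_right L2_integrable_square assms)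
  then have "integrable lborel (\<lambda>x. (cmod (f x + g x))\<^sup>2)"
  proof (rule Bochner_Integration.integrable_bound)
    show "AE x in lborel. norm ((cmod (f x + g x))\<^sup>2) \<le> norm (2 * (cmod (f x))\<^sup>2 + 2 * (cmod (g x))\<^sup>2)"
    proof (rule AE_I2)
      fix x
      have "(cmod (f x + g x))\<^sup>2 \<le> (cmod (f x) + cmod (g x))\<^sup>2"
        by (intro power_mono norm_triangle_ineq) auto
      also have "\<dots> \<le> 2 * (cmod (f x))\<^sup>2 + 2 * (cmod (g x))\<^sup>2"
        using sum_squares_bound[of "cmod (f x)" "cmod (g x)"] by (simp add: power2_sum)
      finally show "norm ((cmod (f x + g x))\<^sup>2) \<le> norm (2 * (cmod (f x))\<^sup>2 + 2 * (cmod (g x))\<^sup>2)"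
        by simp
    qed
  qed simp
  then show ?thesis by (simp add: L2_def)
qed

lemma L2_diff: "f \<in> L2 \<Longrightarrow> g \<in> L2 \<Longrightarrow> (\<lambda>x. f x - g x) \<in> L2"
  using L2_add[of f "\<lambda>x. (-1) * g x"] L2_scale[of g "-1"] by simp

lemma L2_zero: "(\<lambda>x. 0) \<in> L2"
  by (simp add: L2_def)

lemma L2_sum:
  assumes "\<And>i. i \<in> A \<Longrightarrow> f i \<in> L2"
  shows "(\<lambda>x. \<Sum>i\<in>A. f i x) \<in> L2"
  using assms by (induction A rule: infinite_finite_induct) (auto intro: L2_zero L2_add)

lemma L2_inner_integrable:
  assumes "f \<in> L2" "g \<in> L2"
  shows "integrable lborel (\<lambda>x. f x * cnj (g x))"
proof -
  have [measurable]: "f \<in> borel_measurable borel" "g \<in> borel_measurable borel"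
    using assms by (auto dest: L2_measurable)
  have "integrable lborel (\<lambda>x. (cmod (f x))\<^sup>2 + (cmod (g x))\<^sup>2)"
    by (intro Bochner_Integration.integrable_add L2_integrable_square assms)
  then show ?thesis
  proof (rule Bochner_Integration.integrable_bound)
    show "AE x in lborel. norm (f x * cnj (g x)) \<le> norm ((cmod (f x))\<^sup>2 + (cmod (g x))\<^sup>2)"
    proof (rule AE_I2)
      fix x
      have "0 \<le> cmod (f x) * cmod (g x)" by simp
      then have "cmod (f x) * cmod (g x) \<le> (cmod (f x))\<^sup>2 + (cmod (g x))\<^sup>2"
        using sum_squares_bound[of "cmod (f x)" "cmod (g x)"] by linarith
      then show "norm (f x * cnj (g x)) \<le> norm ((cmod (f x))\<^sup>2 + (cmod (g x))\<^sup>2)"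
        by (simp add: norm_mult)
    qed
  qed simp
qed

lemma L2_inner_add_left:
  "f \<in> L2 \<Longrightarrow> g \<in> L2 \<Longrightarrow> h \<in> L2 \<Longrightarrow>
    L2_inner (\<lambda>x. f x + g x) h = L2_inner f h + L2_inner g h"
  by (simp add: L2_inner_def distrib_right L2_inner_integrable)

lemma L2_inner_diff_left:
  "f \<in> L2 \<Longrightarrow> g \<in> L2 \<Longrightarrow> h \<in> L2 \<Longrightarrow>
    L2_inner (\<lambda>x. f x - g x) h = L2_inner f h - L2_inner g h"
  by (simp add: L2_inner_def left_diff_distrib L2_inner_integrable)

lemma L2_inner_scale_left: "L2_inner (\<lambda>x. c * f x) h = c * L2_inner f h"
  by (simp add: L2_inner_def mult.assoc)

lemma L2_inner_commute: "L2_inner g f = cnj (L2_inner f g)"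
proof -
  have "cnj (L2_inner f g) = (LINT x|lborel. cnj (f x * cnj (g x)))"
    unfolding L2_inner_def by (rule Bochner_Integration.integral_cnj[symmetric])
  then show ?thesis by (simp add: L2_inner_def mult.commute)
qed

lemma L2_inner_sum_left:
  assumes "\<And>i. i \<in> A \<Longrightarrow> f i \<in> L2" "g \<in> L2"
  shows "L2_inner (\<lambda>x. \<Sum>i\<in>A. f i x) g = (\<Sum>i\<in>A. L2_inner (f i) g)"
  using assms(1)
proof (induction A rule: infinite_finite_induct)
  case (insert i A)
  then show ?case
    using L2_inner_add_left[of "f i" "\<lambda>x. \<Sum>i\<in>A. f i x" g] assms(2) by (simp add: L2_sum)
qed (simp_all add: L2_inner_def)

lemma L2_inner_self: "L2_inner f f = complex_of_real ((L2_norm f)\<^sup>2)"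
  unfolding L2_inner_def L2_norm_square
  by (subst integral_complex_of_real[symmetric]) (simp only: complex_norm_square)

lemma L2_norm_diff_square:
  assumes "f \<in> L2" "g \<in> L2"
  shows "(L2_norm (\<lambda>x. f x - g x))\<^sup>2 = (L2_norm f)\<^sup>2 - 2 * Re (L2_inner f g) + (L2_norm g)\<^sup>2"
proof -
  have d: "(\<lambda>x. f x - g x) \<in> L2" using assms by (rule L2_diff)
  have r: "L2_inner h (\<lambda>x. f x - g x) = L2_inner h f - L2_inner h g" if "h \<in> L2" for h
    using L2_inner_diff_left[OF assms that] L2_inner_commute[of h] by simp
  have "complex_of_real ((L2_norm (\<lambda>x. f x - g x))\<^sup>2)
      = L2_inner f f - L2_inner f g - (L2_inner g f - L2_inner g g)"
    unfolding L2_inner_self[symmetric] using assms d by (simp add: L2_inner_diff_left r)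
  also have "\<dots> = complex_of_real ((L2_norm f)\<^sup>2 + (L2_norm g)\<^sup>2) - (L2_inner f g + cnj (L2_inner f g))"
    using L2_inner_commute[of g f] by (simp add: L2_inner_self)
  also have "\<dots> = complex_of_real ((L2_norm f)\<^sup>2 - 2 * Re (L2_inner f g) + (L2_norm g)\<^sup>2)"
    by (simp add: complex_add_cnj)
  finally show ?thesis using of_real_eq_iff by blast
qed

lemma L2_Cauchy_Schwarz:
  assumes "f \<in> L2" "g \<in> L2"
  shows "cmod (L2_inner f g) \<le> L2_norm f * L2_norm g"
proof -
  have [measurable]: "f \<in> borel_measurable borel" "g \<in> borel_measurable borel"
    using assms by (auto dest: L2_measurable)
  have "ennreal (cmod (L2_inner f g)) \<le> (\<integral>\<^sup>+x. ennreal (cmod (f x)) * ennreal (cmod (g x)) \<partial>lborel)"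
    unfolding L2_inner_def
    using integral_norm_bound_ennreal[OF L2_inner_integrable[OF assms]]
    by (simp add: norm_mult ennreal_mult)
  then have "(ennreal (cmod (L2_inner f g)))\<^sup>2 \<le> (\<integral>\<^sup>+x. ennreal (cmod (f x)) * ennreal (cmod (g x)) \<partial>lborel)\<^sup>2"
    by (rule power_mono) simp
  also have "\<dots> \<le> (\<integral>\<^sup>+x. (ennreal (cmod (f x)))\<^sup>2 \<partial>lborel) * (\<integral>\<^sup>+x. (ennreal (cmod (g x)))\<^sup>2 \<partial>lborel)"
    by (rule Cauchy_Schwarz_nn_integral) auto
  also have "\<dots> = ennreal ((L2_norm f)\<^sup>2 * (L2_norm g)\<^sup>2)"
    by (simp add: ennreal_power L2_nn_integral assms ennreal_mult)
  finally have "ennreal ((cmod (L2_inner f g))\<^sup>2) \<le> ennreal ((L2_norm f * L2_norm g)\<^sup>2)"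
    by (simp add: ennreal_power power_mult_distrib)
  then have "(cmod (L2_inner f g))\<^sup>2 \<le> (L2_norm f * L2_norm g)\<^sup>2"
    by (subst (asm) ennreal_le_iff) auto
  then show ?thesis
    by (rule power2_le_imp_le) (simp add: L2_norm_nonneg)
qed

lemma L2_norm_orthonormal_sum:
  assumes "\<And>n. e n \<in> L2" "\<And>m n. L2_inner (e m) (e n) = (if m = n then 1 else 0)" "finite A"
  shows "(L2_norm (\<lambda>x. \<Sum>n\<in>A. c n * e n x))\<^sup>2 = (\<Sum>n\<in>A. (cmod (c n))\<^sup>2)"
    and "n \<in> A \<Longrightarrow> L2_inner (\<lambda>x. \<Sum>n\<in>A. c n * e n x) (e n) = c n"
    and "f \<in> L2 \<Longrightarrow> L2_inner (\<lambda>x. \<Sum>n\<in>A. c n * e n x) f = (\<Sum>n\<in>A. c n * cnj (L2_inner f (e n)))"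
proof -
  let ?s = "\<lambda>x. \<Sum>n\<in>A. c n * e n x"
  have s: "?s \<in> L2" by (intro L2_sum L2_scale assms)
  have inner: "L2_inner ?s f = (\<Sum>n\<in>A. c n * cnj (L2_inner f (e n)))" if "f \<in> L2" for f
    using that assms(1) L2_inner_commute[of _ f]
    by (subst L2_inner_sum_left) (auto simp: L2_scale L2_inner_scale_left)
  show "f \<in> L2 \<Longrightarrow> L2_inner ?s f = (\<Sum>n\<in>A. c n * cnj (L2_inner f (e n)))" by (rule inner)
  have coeff: "L2_inner ?s (e n) = c n" if "n \<in> A" for n
  proof -
    have "L2_inner ?s (e n) = (\<Sum>m\<in>A. if n = m then c m else 0)"
      unfolding inner[OF assms(1)] by (intro sum.cong) (auto simp: assms(2))
    then show ?thesis using that assms(3) by simp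
  qed
  then show "n \<in> A \<Longrightarrow> L2_inner ?s (e n) = c n" .
  have "complex_of_real ((L2_norm ?s)\<^sup>2) = (\<Sum>n\<in>A. c n * cnj (c n))"
    unfolding L2_inner_self[symmetric] inner[OF s] by (intro sum.cong) (auto simp: coeff)
  also have "\<dots> = complex_of_real (\<Sum>n\<in>A. (cmod (c n))\<^sup>2)"
    by (simp only: complex_norm_square of_real_sum)
  finally show "(L2_norm ?s)\<^sup>2 = (\<Sum>n\<in>A. (cmod (c n))\<^sup>2)" using of_real_eq_iff by blast
qed

text \<open>The part of the Riesz--Fischer theorem that Parseval's identity needs: a sequence whose increments
decay geometrically in norm converges almost everywhere, and by Fatou's lemma the pointwise limit is
also the limit in norm.\<close>

lemma L2_complete_fast:
  fixes s :: "nat \<Rightarrow> real \<Rightarrow> complex"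
  assumes s: "\<And>k. s k \<in> L2"
    and fast: "\<And>j k. j \<le> k \<Longrightarrow> (L2_norm (\<lambda>x. s k x - s j x))\<^sup>2 \<le> (1/4)^j"
  obtains g where "g \<in> L2" "\<And>j. (L2_norm (\<lambda>x. g x - s j x))\<^sup>2 \<le> (1/4)^j"
proof -
  have [measurable]: "s k \<in> borel_measurable borel" for k using s by (rule L2_measurable)
  (* The squared norms of the increments are at most 4^(-k), so they beat the weight 2^k in the
  sum below; its finiteness almost everywhere bounds d k x by a multiple of 2^(-k/2). *)
  define d where "d k x = s (Suc k) x - s k x" for k x
  have dL: "d k \<in> L2" for k unfolding d_def by (intro L2_diff s)
  have [measurable]: "d k \<in> borel_measurable borel" for k using dL by (rule L2_measurable)
  have "(\<integral>\<^sup>+x. (\<Sum>k. ennreal (2^k * (cmod (d k x))\<^sup>2)) \<partial>lborel)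
      = (\<Sum>k. \<integral>\<^sup>+x. ennreal (2^k * (cmod (d k x))\<^sup>2) \<partial>lborel)"
    by (rule nn_integral_suminf) simp
  also have "\<dots> = (\<Sum>k. ennreal (2^k * (L2_norm (d k))\<^sup>2))"
    by (intro suminf_cong) (simp add: ennreal_mult nn_integral_cmult L2_nn_integral[OF dL])
  also have "\<dots> \<le> (\<Sum>k. ennreal ((1/2)^k))"
  proof (intro suminf_le ennreal_leI)
    fix k
    have "(L2_norm (d k))\<^sup>2 \<le> (1/4)^k" unfolding d_def by (rule fast) simp
    then have "2^k * (L2_norm (d k))\<^sup>2 \<le> 2^k * (1/4)^k" by (rule mult_left_mono) simp
    also have "\<dots> = (1/2::real)^k" by (simp flip: power_mult_distrib)
    finally show "2^k * (L2_norm (d k))\<^sup>2 \<le> (1/2)^k" .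
  qed simp_all
  also have "\<dots> < \<infinity>"
    by (subst suminf_ennreal2) (simp_all add: summable_geometric)
  finally have "(\<integral>\<^sup>+x. (\<Sum>k. ennreal (2^k * (cmod (d k x))\<^sup>2)) \<partial>lborel) \<noteq> \<infinity>" by simp
  then have "AE x in lborel. (\<Sum>k. ennreal (2^k * (cmod (d k x))\<^sup>2)) \<noteq> \<infinity>"
    by (rule nn_integral_PInf_AE[rotated]) simp
  then have conv: "AE x in lborel. convergent (\<lambda>k. s k x)"
  proof eventually_elim
    case (elim x)
    then have "(\<Sum>k. ennreal (2^k * (cmod (d k x))\<^sup>2)) < \<infinity>"
      unfolding infinity_ennreal_def less_top .
    then obtain C where C: "C \<ge> 0" "(\<Sum>k. ennreal (2^k * (cmod (d k x))\<^sup>2)) = ennreal C"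
      unfolding infinity_ennreal_def less_top_ennreal by blast
    have "cmod (d k x) \<le> sqrt C * (sqrt (1/2))^k" for k
    proof -
      have "(\<Sum>i\<in>{k}. ennreal (2^i * (cmod (d i x))\<^sup>2)) \<le> ennreal C"
        unfolding C(2)[symmetric] by (rule sum_le_suminf[OF summableI]) simp_all
      then have "ennreal (2^k * (cmod (d k x))\<^sup>2) \<le> ennreal C" by simp
      then have "2^k * (cmod (d k x))\<^sup>2 \<le> C"
        by (rule ennreal_le_iff[OF C(1), THEN iffD1])
      then have "(cmod (d k x))\<^sup>2 \<le> C / 2^k"
        by (subst pos_le_divide_eq) (auto simp: mult.commute)
      then have "(cmod (d k x))\<^sup>2 \<le> C * (1/2)^k" by (simp add: power_one_over)
      then have "sqrt ((cmod (d k x))\<^sup>2) \<le> sqrt (C * (1/2)^k)" by (rule real_sqrt_le_mono)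
      also have "sqrt (C * (1/2)^k) = sqrt C * (sqrt (1/2))^k"
        by (simp only: real_sqrt_mult real_sqrt_power)
      finally show ?thesis by (simp only: real_sqrt_abs abs_norm_cancel)
    qed
    moreover have "summable (\<lambda>k. sqrt C * (sqrt (1/2))^k)"
      by (intro summable_mult summable_geometric) simp
    ultimately have "summable (\<lambda>k. d k x)"
      by (rule summable_comparison_test'[where N=0, rotated])
    then have "convergent (\<lambda>n. \<Sum>k<n. d k x)" by (simp add: summable_iff_convergent)
    then have "convergent (\<lambda>n. (\<Sum>k<n. d k x) + s 0 x)"
      by (intro convergent_add convergent_const)
    moreover have "(\<Sum>k<n. d k x) + s 0 x = s n x" for n
      unfolding d_def by (subst sum_lessThan_telescope) simp
    ultimately show ?case by simp
  qed
  define g where "g x = lim (\<lambda>k. s k x)" for x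
  have [measurable]: "g \<in> borel_measurable borel" unfolding g_def[abs_def] by measurable
  have *: "(\<integral>\<^sup>+x. ennreal ((cmod (g x - s j x))\<^sup>2) \<partial>lborel) \<le> ennreal ((1/4)^j)" for j
  proof -
    have "(\<integral>\<^sup>+x. ennreal ((cmod (g x - s j x))\<^sup>2) \<partial>lborel)
        = (\<integral>\<^sup>+x. liminf (\<lambda>k. ennreal ((cmod (s k x - s j x))\<^sup>2)) \<partial>lborel)"
    proof (rule nn_integral_cong_AE, use conv in eventually_elim)
      case (elim x)
      then have "(\<lambda>k. s k x) \<longlonglongrightarrow> g x" by (simp add: g_def convergent_LIMSEQ_iff)
      then have "(\<lambda>k. ennreal ((cmod (s k x - s j x))\<^sup>2)) \<longlonglongrightarrow> ennreal ((cmod (g x - s j x))\<^sup>2)"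
        by (intro tendsto_intros)
      then show ?case by (intro lim_imp_Liminf[symmetric]) simp_all
    qed
    also have "\<dots> \<le> liminf (\<lambda>k. \<integral>\<^sup>+x. ennreal ((cmod (s k x - s j x))\<^sup>2) \<partial>lborel)"
      by (rule nn_integral_liminf) simp
    also have "\<dots> \<le> ennreal ((1/4)^j)"
    proof (rule Liminf_le[OF trivial_limit_sequentially])
      show "\<forall>\<^sub>F k in sequentially. (\<integral>\<^sup>+x. ennreal ((cmod (s k x - s j x))\<^sup>2) \<partial>lborel) \<le> ennreal ((1/4)^j)"
        using eventually_ge_at_top[of j]
        by eventually_elim (subst L2_nn_integral, auto intro!: L2_diff s ennreal_leI fast)
    qed
    finally show ?thesis .
  qed
  have gs: "(\<lambda>x. g x - s j x) \<in> L2" for j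
  proof (rule L2I)
    show "(\<integral>\<^sup>+x. ennreal ((cmod (g x - s j x))\<^sup>2) \<partial>lborel) < \<infinity>"
      using *[of j] by (rule le_less_trans) simp
  qed simp
  show thesis
  proof (rule that)
    have "(\<lambda>x. (g x - s 0 x) + s 0 x) \<in> L2" by (intro L2_add gs s)
    then show "g \<in> L2" by simp
    show "(L2_norm (\<lambda>x. g x - s j x))\<^sup>2 \<le> (1/4)^j" for j
      using *[of j] unfolding L2_nn_integral[OF gs] by (subst (asm) ennreal_le_iff) auto
  qed
qed

text \<open>Completeness of a basis is given only as the absence of a nonzero orthogonal vector. Along a sparse
subsequence the Fourier sums converge to some \<open>g\<close> by \<open>L2_complete_fast\<close>; \<open>f - g\<close> is orthogonal to
the basis, hence zero.\<close>

theorem L2_parseval: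
  assumes e: "L2_orthonormal_basis e" and f: "f \<in> L2"
  shows "(\<lambda>n. (cmod (L2_inner f (e n)))\<^sup>2) sums (L2_norm f)\<^sup>2"
proof -
  have eL: "\<And>n. e n \<in> L2" and on: "\<And>m n. L2_inner (e m) (e n) = (if m = n then 1 else 0)"
    and compl: "\<And>f. f \<in> L2 \<Longrightarrow> (\<And>n. L2_inner f (e n) = 0) \<Longrightarrow> (AE x in lborel. f x = 0)"
    using e by (auto simp: L2_orthonormal_basis_def)
  define c where "c n = L2_inner f (e n)" for n
  define S where "S N x = (\<Sum>n<N. c n * e n x)" for N :: nat and x
  have SL: "S N \<in> L2" for N unfolding S_def by (intro L2_sum L2_scale eL)
  have SS: "(L2_norm (S N))\<^sup>2 = (\<Sum>n<N. (cmod (c n))\<^sup>2)" for N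
    unfolding S_def using L2_norm_orthonormal_sum(1)[OF eL on] by simp
  have fS: "(L2_norm (\<lambda>x. S N x - f x))\<^sup>2 = (L2_norm f)\<^sup>2 - (\<Sum>n<N. (cmod (c n))\<^sup>2)" for N
  proof -
    have "L2_inner (S N) f = complex_of_real (\<Sum>n<N. (cmod (c n))\<^sup>2)"
      unfolding S_def using L2_norm_orthonormal_sum(3)[OF eL on _ f, of "{..<N}" c]
      by (simp add: c_def complex_norm_square del: of_real_power)
    then show ?thesis by (simp add: L2_norm_diff_square[OF SL f] SS)
  qed
  have bessel: "(\<Sum>n<N. (cmod (c n))\<^sup>2) \<le> (L2_norm f)\<^sup>2" for N
    using fS[of N] zero_le_power2[of "L2_norm (\<lambda>x. S N x - f x)"] by linarith
  have sm: "summable (\<lambda>n. (cmod (c n))\<^sup>2)"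
    by (rule summableI_nonneg_bounded[OF _ bessel]) simp
  have "\<exists>N. \<forall>m\<ge>N. \<forall>n. norm (\<Sum>i\<in>{m..<n}. (cmod (c i))\<^sup>2) < (1/4)^k" for k
    using sm unfolding summable_Cauchy by (rule spec[of _ "(1/4)^k", THEN mp]) simp
  then obtain N where N: "\<And>k m n. m \<ge> N k \<Longrightarrow> norm (\<Sum>i\<in>{m..<n}. (cmod (c i))\<^sup>2) < (1/4)^k"
    by metis
  (* Summing makes the chosen thresholds strictly increasing; each r k still exceeds N k. *)
  define r where "r k = (\<Sum>i\<le>k. Suc (N i))" for k
  have rN: "r k \<ge> N k" for k
    unfolding r_def using member_le_sum[of k "{..k}" "\<lambda>i. Suc (N i)"] by simp
  have r_strict: "strict_mono r" unfolding r_def by (rule strict_monoI_Suc) simp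
  then have rmono: "j \<le> k \<Longrightarrow> r j \<le> r k" for j k by (simp add: strict_mono_less_eq)
  have fast: "(L2_norm (\<lambda>x. S (r k) x - S (r j) x))\<^sup>2 \<le> (1/4)^j" if "j \<le> k" for j k
  proof -
    have "(\<lambda>x. S (r k) x - S (r j) x) = (\<lambda>x. \<Sum>n\<in>{r j..<r k}. c n * e n x)"
    proof
      fix x
      have "{..<r k} = {..<r j} \<union> {r j..<r k}" using rmono[OF that] by auto
      then show "S (r k) x - S (r j) x = (\<Sum>n\<in>{r j..<r k}. c n * e n x)"
        unfolding S_def by (simp add: sum.union_disjoint ivl_disj_int)
    qed
    then have "(L2_norm (\<lambda>x. S (r k) x - S (r j) x))\<^sup>2 = (\<Sum>n\<in>{r j..<r k}. (cmod (c n))\<^sup>2)"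
      using L2_norm_orthonormal_sum(1)[OF eL on] by simp
    also have "\<dots> < (1/4)^j" using N[OF rN[of j], of "r k"] by (simp add: sum_nonneg)
    finally show ?thesis by simp
  qed
  obtain g where g: "g \<in> L2" and gS: "\<And>j. (L2_norm (\<lambda>x. g x - S (r j) x))\<^sup>2 \<le> (1/4)^j"
    using L2_complete_fast[of "\<lambda>k. S (r k)", OF SL fast] by blast
  have tends: "(\<lambda>j. L2_norm (\<lambda>x. g x - S (r j) x)) \<longlonglongrightarrow> 0"
  proof (rule tendsto_sandwich[of "\<lambda>_. 0"])
    show "\<forall>\<^sub>F j in sequentially. L2_norm (\<lambda>x. g x - S (r j) x) \<le> (1/2)^j"
    proof (rule always_eventually, rule allI)
      fix j
      have "((1/2::real)^j)\<^sup>2 = ((1/2)\<^sup>2)^j" by (metis power_mult mult.commute)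
      also have "\<dots> = (1/4)^j" by (simp add: power2_eq_square)
      finally have "((1/2::real)^j)\<^sup>2 = (1/4)^j" .
      from gS[of j, folded this] show "L2_norm (\<lambda>x. g x - S (r j) x) \<le> (1/2)^j"
        by (rule power2_le_imp_le) simp
    qed
    show "(\<lambda>j. (1/2::real)^j) \<longlonglongrightarrow> 0" by (rule LIMSEQ_power_zero) simp
  qed (auto simp: L2_norm_nonneg)
  have "L2_inner g (e m) = c m" for m
  proof -
    have enorm: "L2_norm (e m) = 1"
    proof -
      have "complex_of_real ((L2_norm (e m))\<^sup>2) = 1" using L2_inner_self[of "e m"] on[of m m] by simp
      then have "(L2_norm (e m))\<^sup>2 = 1" using of_real_eq_1_iff by blast
      then show ?thesis using L2_norm_nonneg[of "e m"] by (simp add: power2_eq_1_iff)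
    qed
    have ev: "\<forall>\<^sub>F j in sequentially. cmod (L2_inner g (e m) - c m) \<le> L2_norm (\<lambda>x. g x - S (r j) x)"
      using eventually_gt_at_top[of m]
    proof eventually_elim
      case (elim j)
      then have "m < r j" using strict_mono_imp_increasing[OF r_strict, of j] by simp
      then have "L2_inner (S (r j)) (e m) = c m"
        unfolding S_def using L2_norm_orthonormal_sum(2)[OF eL on] by simp
      then have "L2_inner g (e m) - c m = L2_inner (\<lambda>x. g x - S (r j) x) (e m)"
        by (simp add: L2_inner_diff_left g SL eL)
      then show ?case
        using L2_Cauchy_Schwarz[OF L2_diff[OF g SL] eL, of "r j" m] enorm by simp
    qed
    then have "cmod (L2_inner g (e m) - c m) \<le> 0"
      using tends by (intro tendsto_lowerbound[of _ 0 sequentially]) auto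
    then show ?thesis by simp
  qed
  then have "AE x in lborel. f x - g x = 0"
    by (intro compl L2_diff f g) (simp add: L2_inner_diff_left f g eL c_def)
  then have "(L2_norm (\<lambda>x. S N x - f x))\<^sup>2 = (L2_norm (\<lambda>x. g x - S N x))\<^sup>2" for N
    unfolding L2_norm_square using f g SL
    by (intro integral_cong_AE) (auto simp: norm_minus_commute dest!: L2_measurable)
  then have "(\<lambda>j. (L2_norm f)\<^sup>2 - (\<Sum>n<r j. (cmod (c n))\<^sup>2)) \<longlonglongrightarrow> 0\<^sup>2"
    unfolding fS[symmetric] using tendsto_power[OF tends, of 2] by simp
  then have "(\<lambda>j. (L2_norm f)\<^sup>2 - ((L2_norm f)\<^sup>2 - (\<Sum>n<r j. (cmod (c n))\<^sup>2))) \<longlonglongrightarrow> (L2_norm f)\<^sup>2 - 0\<^sup>2"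
    by (intro tendsto_diff tendsto_const)
  moreover have "(\<lambda>j. \<Sum>n<r j. (cmod (c n))\<^sup>2) \<longlonglongrightarrow> (\<Sum>n. (cmod (c n))\<^sup>2)"
    using LIMSEQ_subseq_LIMSEQ[OF summable_LIMSEQ[OF sm] r_strict] by (simp add: o_def)
  ultimately have "(\<Sum>n. (cmod (c n))\<^sup>2) = (L2_norm f)\<^sup>2"
    using LIMSEQ_unique by fastforce
  then show ?thesis using summable_sums[OF sm] by (simp add: c_def)
qed

section \<open>Local traces as masses of the squared kernel\<close>

text \<open>All covariances below are expressed as masses of rectangles under this measure, so that passing to
limits and splitting domains become elementary measure theory, with infinite values allowed until
finiteness is proved.\<close>

definition kernel_measure :: "(real \<Rightarrow> real \<Rightarrow> complex) \<Rightarrow> (real \<times> real) measure" where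
  "kernel_measure K = density (lborel \<Otimes>\<^sub>M lborel) (\<lambda>(x, y). ennreal ((cmod (K x y))\<^sup>2))"

lemma sets_kernel_measure [simp, measurable_cong]:
  "sets (kernel_measure K) = sets (lborel \<Otimes>\<^sub>M lborel)"
  by (simp add: kernel_measure_def)

lemma sets_pair_lborel_Times [measurable]:
  "A \<in> sets borel \<Longrightarrow> B \<in> sets borel \<Longrightarrow> A \<times> B \<in> sets (lborel \<Otimes>\<^sub>M lborel)"
  by (intro pair_measureI) auto

lemma integral_kernel_measurable:
  "integral_kernel K T \<Longrightarrow> case_prod K \<in> borel_measurable (lborel \<Otimes>\<^sub>M lborel)"
  by (simp add: integral_kernel_def)

lemma emeasure_kernel_measure:
  assumes [measurable]: "case_prod K \<in> borel_measurable (lborel \<Otimes>\<^sub>M lborel)"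
    and [measurable]: "S \<in> sets (lborel \<Otimes>\<^sub>M lborel)"
  shows "emeasure (kernel_measure K) S =
    (\<integral>\<^sup>+z. ennreal ((cmod (case_prod K z))\<^sup>2) * indicator S z \<partial>(lborel \<Otimes>\<^sub>M lborel))"
  unfolding kernel_measure_def by (subst emeasure_density) (use assms in \<open>auto simp: split_beta\<close>)

lemma emeasure_kernel_measure_Times:
  assumes [measurable]: "case_prod K \<in> borel_measurable (lborel \<Otimes>\<^sub>M lborel)"
    "A \<in> sets borel" "D \<in> sets borel"
  shows "emeasure (kernel_measure K) (A \<times> D) =
    (\<integral>\<^sup>+x. (\<integral>\<^sup>+y. ennreal ((cmod (K x y))\<^sup>2) * indicator D y \<partial>lborel) * indicator A x \<partial>lborel)"
proof -
  have "emeasure (kernel_measure K) (A \<times> D) =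
      (\<integral>\<^sup>+x. \<integral>\<^sup>+y. ennreal ((cmod (K x y))\<^sup>2) * indicator (A \<times> D) (x, y) \<partial>lborel \<partial>lborel)"
    by (subst emeasure_kernel_measure) (auto simp: lborel.nn_integral_fst[symmetric])
  also have "\<dots> = (\<integral>\<^sup>+x. (\<integral>\<^sup>+y. ennreal ((cmod (K x y))\<^sup>2) * indicator D y \<partial>lborel) * indicator A x \<partial>lborel)"
    by (intro nn_integral_cong) (auto simp: indicator_def intro!: nn_integral_cong)
  finally show ?thesis .
qed

lemma J_hermitian_cmod:
  assumes "J_hermitian K" "x \<noteq> 0" "y \<noteq> 0"
  shows "cmod (K x y) = cmod (K y x)"
proof -
  have "K x y = complex_of_real (sgn x * sgn y) * cnj (K y x)"
    using assms unfolding J_hermitian_def by blast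
  then have "cmod (K x y) = cmod (complex_of_real (sgn x * sgn y) * cnj (K y x))" by (rule arg_cong)
  also have "\<dots> = \<bar>sgn x * sgn y\<bar> * cmod (K y x)" by (simp only: norm_mult norm_of_real complex_mod_cnj)
  also have "\<bar>sgn x * sgn y\<bar> = 1" using assms by (auto simp: sgn_if)
  finally show ?thesis by simp
qed

lemma kernel_measure_swap:
  assumes J: "J_hermitian K" and [measurable]: "case_prod K \<in> borel_measurable (lborel \<Otimes>\<^sub>M lborel)"
    and [measurable]: "A \<in> sets borel" "D \<in> sets borel"
  shows "emeasure (kernel_measure K) (A \<times> D) = emeasure (kernel_measure K) (D \<times> A)"
proof -
  have nz: "AE x in lborel. x \<noteq> (0::real)" by (rule AE_lborel_singleton)
  have "emeasure (kernel_measure K) (A \<times> D) =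
      (\<integral>\<^sup>+x. \<integral>\<^sup>+y. ennreal ((cmod (K x y))\<^sup>2) * indicator D y * indicator A x \<partial>lborel \<partial>lborel)"
    by (simp add: emeasure_kernel_measure_Times nn_integral_multc)
  also have "\<dots> = (\<integral>\<^sup>+y. \<integral>\<^sup>+x. ennreal ((cmod (K x y))\<^sup>2) * indicator D y * indicator A x \<partial>lborel \<partial>lborel)"
    by (rule lborel_pair.Fubini'[symmetric]) measurable
  also have "\<dots> = (\<integral>\<^sup>+y. \<integral>\<^sup>+x. ennreal ((cmod (K y x))\<^sup>2) * indicator A x * indicator D y \<partial>lborel \<partial>lborel)"
    using nz by (intro nn_integral_cong_AE, eventually_elim, intro nn_integral_cong_AE, use nz in eventually_elim)
       (auto simp: J_hermitian_cmod[OF J] mult_ac)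
  also have "\<dots> = emeasure (kernel_measure K) (D \<times> A)"
    by (simp add: emeasure_kernel_measure_Times nn_integral_multc)
  finally show ?thesis .
qed

lemma L2_restrict: "f \<in> L2 \<Longrightarrow> D \<in> sets borel \<Longrightarrow> mult_op (indicator D) f \<in> L2"
  unfolding mult_op_def by (rule L2_mult_bounded[where c=1]) (auto simp: indicator_def)

lemma orthogonal_projection_inner:
  assumes H: "L2_orthogonal_projection H" and g: "g \<in> L2"
  shows "L2_inner (H g) g = complex_of_real ((L2_norm (H g))\<^sup>2)"
proof -
  have Hg: "H g \<in> L2" and HHg: "H (H g) \<in> L2" and adj: "L2_inner (H (H g)) g = L2_inner (H g) (H g)"
    using H g by (auto simp: L2_orthogonal_projection_def L2_adjoint_def L2_bounded_linear_def)
  have "AE x in lborel. H (H g) x = H g x"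
    using H g by (simp add: L2_orthogonal_projection_def)
  moreover have [measurable]: "g \<in> borel_measurable borel" "H g \<in> borel_measurable borel"
      "H (H g) \<in> borel_measurable borel"
    using g Hg HHg by (auto dest: L2_measurable)
  ultimately have "L2_inner (H (H g)) g = L2_inner (H g) g"
    unfolding L2_inner_def by (intro integral_cong_AE) auto
  then show ?thesis using adj L2_inner_self by simp
qed

text \<open>For \<open>g\<close> supported on one side of the origin, \<open>\<langle>Hg, g\<rangle> = \<parallel>Hg\<parallel>\<^sup>2\<close> for the projection \<open>H = hat_op T\<close>
becomes \<open>\<langle>Tg, g\<rangle> = \<parallel>Tg\<parallel>\<^sup>2\<close>. On the positive side \<open>Hg = sgn \<cdot> Tg\<close> and this is immediate. On the
negative side \<open>Hg = sgn \<cdot> Tg + g\<close>; the terms \<open>\<parallel>g\<parallel>\<^sup>2\<close> cancel, and the remaining identity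
\<open>- \<langle>Tg, g\<rangle> = \<parallel>Tg\<parallel>\<^sup>2 - 2 Re \<langle>Tg, g\<rangle>\<close> first shows that \<open>\<langle>Tg, g\<rangle>\<close> is real and then gives its value.\<close>

lemma compressed_form_eq_norm_square:
  assumes T: "L2_bounded_linear T" and H: "L2_orthogonal_projection (hat_op T)"
    and D[measurable]: "D \<in> sets borel" and half: "D \<subseteq> {0<..} \<or> D \<subseteq> {..<0}"
    and f: "f \<in> L2"
  shows "L2_inner (compress D T D f) f = complex_of_real ((L2_norm (T (mult_op (indicator D) f)))\<^sup>2)"
proof -
  define g where "g = mult_op (indicator D) f"
  have g: "g \<in> L2" unfolding g_def by (rule L2_restrict[OF f D])
  have Tg: "T g \<in> L2" using T g by (simp add: L2_bounded_linear_def)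
  have g0: "x \<notin> D \<Longrightarrow> g x = 0" for x by (simp add: g_def mult_op_def)
  have [measurable]: "T g \<in> borel_measurable borel" "g \<in> borel_measurable borel"
    using Tg g by (auto dest: L2_measurable)
  define u where "u x = complex_of_real (sgn x) * T g x" for x
  have u: "u \<in> L2" unfolding u_def by (rule L2_mult_bounded[OF Tg, where c=1]) (auto simp: sgn_if)
  have uT: "(L2_norm u)\<^sup>2 = (L2_norm (T g))\<^sup>2"
    unfolding L2_norm_square
  proof (rule integral_cong_AE)
    show "AE x in lborel. (cmod (u x))\<^sup>2 = (cmod (T g x))\<^sup>2"
      using AE_lborel_singleton[of "0::real"]
      by eventually_elim (auto simp: u_def norm_mult sgn_if)
  qed (use u in \<open>auto dest: L2_measurable\<close>)
  have "L2_inner (compress D T D f) f = L2_inner (T g) g"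
    unfolding L2_inner_def compress_def o_def g_def[symmetric]
    by (intro Bochner_Integration.integral_cong) (auto simp: g_def mult_op_def indicator_def)
  also have "\<dots> = complex_of_real ((L2_norm (T g))\<^sup>2)"
    using half
  proof
    assume pos: "D \<subseteq> {0<..}"
    have Hg: "hat_op T g = u"
      using pos by (auto simp: fun_eq_iff hat_op_def mult_op_def u_def g_def indicator_def)
    have "L2_inner u g = L2_inner (T g) g"
      unfolding L2_inner_def
      by (intro Bochner_Integration.integral_cong) (use pos g0 in \<open>force simp: u_def\<close>)+
    then show ?thesis using orthogonal_projection_inner[OF H g] by (simp add: Hg uT)
  next
    assume neg: "D \<subseteq> {..<0}"
    have Hg: "hat_op T g = (\<lambda>x. u x + g x)"
      using neg by (auto simp: fun_eq_iff hat_op_def mult_op_def u_def g_def indicator_def)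
    have "u x * cnj (g x) = - (T g x * cnj (g x))" for x
    proof (cases "x \<in> D")
      case True
      then have "sgn x = -1" using neg by auto
      then show ?thesis by (simp add: u_def)
    qed (simp add: g0)
    then have ug: "L2_inner u g = - L2_inner (T g) g" by (simp add: L2_inner_def)
    have mg: "(\<lambda>x. (-1) * g x) \<in> L2" by (rule L2_scale[OF g])
    have ng: "L2_norm (\<lambda>x. - g x) = L2_norm g" by (simp add: L2_norm_def)
    have "(L2_norm (\<lambda>x. u x + g x))\<^sup>2 = (L2_norm u)\<^sup>2 + 2 * Re (L2_inner u g) + (L2_norm g)\<^sup>2"
      using L2_norm_diff_square[OF u mg] by (simp add: ng) (simp add: L2_inner_def)
    then have eq: "L2_inner u g + L2_inner g g =
        complex_of_real ((L2_norm (T g))\<^sup>2 + 2 * Re (L2_inner u g) + (L2_norm g)\<^sup>2)"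
      using orthogonal_projection_inner[OF H g] by (simp add: Hg uT L2_inner_add_left u g)
    then have eq': "L2_inner u g = complex_of_real ((L2_norm (T g))\<^sup>2 + 2 * Re (L2_inner u g))"
      by (simp add: L2_inner_self)
    from arg_cong[OF eq', of Re]
    have "Re (L2_inner u g) = (L2_norm (T g))\<^sup>2 + 2 * Re (L2_inner u g)"
      unfolding Re_complex_of_real .
    then show ?thesis using eq' by (simp add: ug)
  qed
  finally show ?thesis unfolding g_def .
qed

text \<open>The trace over the basis is \<open>\<Sum>\<^sub>n \<integral> |\<langle>h\<^sub>x, e\<^sub>n\<rangle>|\<^sup>2 dx\<close> with \<open>h\<^sub>x\<close> the conjugate of \<open>K(x, \<cdot>) \<chi>\<^sub>D\<close>, and
Parseval's identity applies for almost every \<open>x\<close> because the local finiteness \<open>loc\<close> puts \<open>h\<^sub>x\<close> in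
\<open>L2\<close>. The equality thus also proves that \<open>\<rho>(D \<times> \<real>)\<close> is finite.\<close>

theorem trace_eq_kernel_measure:
  assumes T: "integral_kernel K T" and J: "J_hermitian K"
    and tr: "diagonal_gives_local_traces K T"
    and H: "L2_orthogonal_projection (hat_op T)" and e: "L2_orthonormal_basis e"
    and D[measurable]: "D \<in> sets borel" and bd: "bounded D" and half: "D \<subseteq> {0<..} \<or> D \<subseteq> {..<0}"
    and loc: "\<And>n::nat. emeasure (kernel_measure K) ({-real n..real n} \<times> D) < \<infinity>"
  shows "emeasure (kernel_measure K) (D \<times> UNIV) = ennreal (Re (LINT x:D|lborel. K x x))"
proof -
  have K[measurable]: "case_prod K \<in> borel_measurable (lborel \<Otimes>\<^sub>M lborel)"
    and TB: "L2_bounded_linear T" using T by (auto simp: integral_kernel_def)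
  have eL: "e n \<in> L2" for n using e by (simp add: L2_orthonormal_basis_def)
  define g where "g n = mult_op (indicator D) (e n)" for n
  have g: "g n \<in> L2" for n unfolding g_def by (rule L2_restrict[OF eL D])
  have Tg: "T (g n) \<in> L2" for n using TB g by (simp add: L2_bounded_linear_def)
  have [measurable]: "T (g n) \<in> borel_measurable borel" for n using Tg by (rule L2_measurable)
  define h where "h x y = cnj (K x y) * indicator D y" for x y
  have h_meas [measurable]: "h x \<in> borel_measurable borel" for x
    unfolding h_def[abs_def] by measurable
  have h_sq: "ennreal ((cmod (h x y))\<^sup>2) = ennreal ((cmod (K x y))\<^sup>2) * indicator D y" for x y
    by (simp add: h_def norm_mult indicator_def)
  have hL: "AE x in lborel. h x \<in> L2"
  proof -
    have "AE x in lborel. x \<in> {-real n..real n} \<longrightarrow> h x \<in> L2" for n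
    proof -
      have "(\<integral>\<^sup>+x. (\<integral>\<^sup>+y. ennreal ((cmod (h x y))\<^sup>2) \<partial>lborel) * indicator {-real n..real n} x \<partial>lborel) \<noteq> \<infinity>"
        using loc[of n] by (simp add: emeasure_kernel_measure_Times h_sq)
      then have "AE x in lborel. (\<integral>\<^sup>+y. ennreal ((cmod (h x y))\<^sup>2) \<partial>lborel) * indicator {-real n..real n} x \<noteq> \<infinity>"
        by (rule nn_integral_PInf_AE[rotated]) (simp add: h_sq)
      then show ?thesis
        by eventually_elim (auto intro!: L2I simp: top.not_eq_extremum)
    qed
    then have "AE x in lborel. \<forall>n. x \<in> {-real n..real n} \<longrightarrow> h x \<in> L2"
      unfolding AE_all_countable by blast
    then show ?thesis
    proof eventually_elim
      case (elim x)
      obtain n where "\<bar>x\<bar> \<le> real n" using real_arch_simple by blast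
      then show ?case using elim[rule_format, of n] by (auto simp: abs_le_iff)
    qed
  qed
  have Tgh: "AE x in lborel. \<forall>n. cmod (T (g n) x) = cmod (L2_inner (h x) (e n))"
    unfolding AE_all_countable
  proof
    fix n
    have "AE x in lborel. T (g n) x = (LINT y|lborel. K x y * g n y)"
      using T g[of n] by (auto simp: integral_kernel_def)
    then show "AE x in lborel. cmod (T (g n) x) = cmod (L2_inner (h x) (e n))"
    proof eventually_elim
      case (elim x)
      have "K x y * g n y = e n y * cnj (h x y)" for y
        by (simp add: g_def mult_op_def h_def indicator_def)
      then have "T (g n) x = L2_inner (e n) (h x)" using elim by (simp add: L2_inner_def)
      then show ?case using L2_inner_commute[of "e n" "h x"] by simp
    qed
  qed
  have "L2_has_trace (compress D T D) (LINT x:D|lborel. K x x)"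
    using tr D bd half unfolding diagonal_gives_local_traces_def by blast
  then have "(\<lambda>n. L2_inner (compress D T D (e n)) (e n)) sums (LINT x:D|lborel. K x x)"
    using e unfolding L2_has_trace_def by blast
  then have t: "(\<lambda>n. complex_of_real ((L2_norm (T (g n)))\<^sup>2)) sums (LINT x:D|lborel. K x x)"
    unfolding compressed_form_eq_norm_square[OF TB H D half eL] g_def .
  have "ennreal (Re (LINT x:D|lborel. K x x)) = (\<Sum>n. ennreal ((L2_norm (T (g n)))\<^sup>2))"
    using sums_Re[OF t] by (intro suminf_ennreal_eq[symmetric]) auto
  also have "\<dots> = (\<Sum>n. \<integral>\<^sup>+x. ennreal ((cmod (T (g n) x))\<^sup>2) \<partial>lborel)"
    by (simp add: L2_nn_integral[OF Tg])
  also have "\<dots> = (\<integral>\<^sup>+x. (\<Sum>n. ennreal ((cmod (T (g n) x))\<^sup>2)) \<partial>lborel)"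
    by (rule nn_integral_suminf[symmetric]) simp
  also have "\<dots> = (\<integral>\<^sup>+x. (\<integral>\<^sup>+y. ennreal ((cmod (h x y))\<^sup>2) \<partial>lborel) \<partial>lborel)"
  proof (rule nn_integral_cong_AE, use Tgh hL in eventually_elim)
    case (elim x)
    have "(\<Sum>n. ennreal ((cmod (L2_inner (h x) (e n)))\<^sup>2)) = ennreal ((L2_norm (h x))\<^sup>2)"
      using L2_parseval[OF e elim(2)] by (intro suminf_ennreal_eq) auto
    then show ?case using elim by (simp add: L2_nn_integral)
  qed
  also have "\<dots> = emeasure (kernel_measure K) (UNIV \<times> D)"
    by (simp add: emeasure_kernel_measure_Times h_sq)
  also have "\<dots> = emeasure (kernel_measure K) (D \<times> UNIV)"
    by (rule kernel_measure_swap[OF J K]) auto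
  finally show ?thesis ..
qed

section \<open>First and second moments of counts\<close>

lemma sets_conf_space:
  "sets conf_space = sigma_sets Conf {{X \<in> Conf. card (X \<inter> B) = n} | B n. bounded B \<and> B \<in> sets borel}"
  unfolding conf_space_def by (rule sets_measure_of) auto

lemma space_conf_space: "space conf_space = Conf"
  unfolding conf_space_def by (rule space_measure_of) auto

lemma measurable_card_conf:
  assumes "bounded D" "D \<in> sets borel"
  shows "(\<lambda>X. card (X \<inter> D)) \<in> measurable conf_space (count_space UNIV)"
proof -
  have "(\<lambda>X. card (X \<inter> D)) -` {n} \<inter> space conf_space \<in> sets conf_space" for n
  proof -
    have "(\<lambda>X. card (X \<inter> D)) -` {n} \<inter> space conf_space = {X \<in> Conf. card (X \<inter> D) = n}"
      by (auto simp: space_conf_space)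
    also have "\<dots> \<in> sets conf_space"
      unfolding sets_conf_space using assms by (intro sigma_sets.Basic) auto
    finally show ?thesis .
  qed
  then show ?thesis
    by (subst measurable_count_space_eq2_countable) auto
qed

lemma Conf_finite: "X \<in> Conf \<Longrightarrow> bounded D \<Longrightarrow> finite (X \<inter> D)"
  by (simp add: Conf_def)

lemma det_mat_one:
  fixes A :: "nat \<Rightarrow> nat \<Rightarrow> complex"
  shows "Determinant.det (Matrix.mat 1 1 (\<lambda>(i, j). A i j)) = A 0 0"
  by (subst det_single) auto

lemma det_mat_two:
  fixes A :: "nat \<Rightarrow> nat \<Rightarrow> complex"
  shows "Determinant.det (Matrix.mat 2 2 (\<lambda>(i, j). A i j)) = A 0 0 * A 1 1 - A 0 1 * A 1 0"
proof -
  let ?M = "Matrix.mat 2 2 (\<lambda>(i, j). A i j)"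
  have minor: "Determinant.det (mat_delete ?M 0 j) = A 1 (1 - j)" if "j < 2" for j
    using that by (subst det_single) (auto simp: mat_delete_def less_2_cases_iff)
  have "Determinant.det ?M = (\<Sum>j<2. ?M $$ (0, j) * cofactor ?M 0 j)"
    by (rule laplace_expansion_row) auto
  also have "\<dots> = A 0 0 * A 1 1 - A 0 1 * A 1 0"
    using minor[of 0] minor[of 1] by (simp add: numeral_2_eq_2 cofactor_def)
  finally show ?thesis .
qed

text \<open>Correlation integrals are taken over \<open>\<Pi>\<^sub>M i\<in>{..<k}\<close>; this lemma and the next one transport them to
the line and to the plane.\<close>

lemma distr_PiM_one:
  "distr (\<Pi>\<^sub>M i\<in>{..<1::nat}. lborel) lborel (\<lambda>x. x 0 :: real) = lborel"
  (is "distr ?P ?L ?f = _")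
proof (rule measure_eqI)
  interpret product_sigma_finite "\<lambda>i::nat. lborel :: real measure" by standard
  have one: "{..<1} = {0::nat}" by auto
  fix A assume "A \<in> sets (distr ?P ?L ?f)"
  then have A[measurable]: "A \<in> sets borel" by simp
  have f: "?f \<in> ?P \<rightarrow>\<^sub>M ?L" by (intro measurable_component_singleton) auto
  have "emeasure (distr ?P ?L ?f) A = (\<integral>\<^sup>+x. indicator A x \<partial>distr ?P ?L ?f)" by simp
  also have "\<dots> = (\<integral>\<^sup>+x. indicator A (x 0) \<partial>?P)"
    by (rule nn_integral_distr[OF f]) simp
  also have "\<dots> = (\<integral>\<^sup>+x. indicator A x \<partial>?L)"
    unfolding one by (rule product_nn_integral_singleton) simp
  finally show "emeasure (distr ?P ?L ?f) A = emeasure ?L A" by simp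
qed simp

lemma distr_PiM_two:
  "distr (\<Pi>\<^sub>M i\<in>{..<2::nat}. lborel) (lborel \<Otimes>\<^sub>M lborel) (\<lambda>x. (x 0, x 1 :: real)) = lborel \<Otimes>\<^sub>M lborel"
  (is "distr ?P ?L ?f = _")
proof (rule measure_eqI)
  interpret product_sigma_finite "\<lambda>i::nat. lborel :: real measure" by standard
  have two: "{..<2} = {0, 1::nat}" by auto
  fix A assume "A \<in> sets (distr ?P ?L ?f)"
  then have A: "A \<in> sets ?L" by simp
  then have ind: "indicator A \<in> borel_measurable ?L" by simp
  have f: "?f \<in> ?P \<rightarrow>\<^sub>M ?L" by (intro measurable_Pair measurable_component_singleton) auto
  have "emeasure (distr ?P ?L ?f) A = (\<integral>\<^sup>+z. indicator A z \<partial>distr ?P ?L ?f)" using A by simp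
  also have "\<dots> = (\<integral>\<^sup>+x. indicator A (x 0, x 1) \<partial>?P)"
    by (rule nn_integral_distr[OF f]) (use ind in simp)
  also have "\<dots> = (\<integral>\<^sup>+z. indicator A (fst z, snd z) \<partial>?L)"
    unfolding two using ind
    by (intro product_nn_integral_pair[of "\<lambda>x y. indicator A (x, y)"]) (auto simp: split_beta)
  also have "\<dots> = emeasure ?L A" using A by simp
  finally show "emeasure (distr ?P ?L ?f) A = emeasure ?L A" .
qed simp

locale hermitian_process =
  fixes K :: "real \<Rightarrow> real \<Rightarrow> complex" and P :: "real set measure"
  assumes K_meas [measurable]: "case_prod K \<in> borel_measurable (lborel \<Otimes>\<^sub>M lborel)"
    and J: "J_hermitian K"
    and det: "determinantal K P"
begin

sublocale prob_space P using det by (simp add: determinantal_def)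

lemma sets_P [measurable_cong]: "sets P = sets conf_space"
  using det by (simp add: determinantal_def)

lemma space_P: "space P = Conf"
  using sets_eq_imp_space_eq[OF sets_P] by (simp add: space_conf_space)

abbreviation rho :: "(real \<times> real) measure" where "rho \<equiv> kernel_measure K"

definition count_in :: "real set \<Rightarrow> real set \<Rightarrow> real" where "count_in D X = real (card (X \<inter> D))"

definition mean_count :: "real set \<Rightarrow> real" where "mean_count D = expectation (count_in D)"

lemma count_in_measurable [measurable]:
  assumes "bounded D" "D \<in> sets borel"
  shows "count_in D \<in> borel_measurable P" "count_in D \<in> borel_measurable conf_space"
proof -
  show "count_in D \<in> borel_measurable conf_space"
    unfolding count_in_def using measurable_card_conf[OF assms] by measurable
  then show "count_in D \<in> borel_measurable P" by (simp cong: measurable_cong_sets add: sets_P)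
qed

lemma joint_moment:
  fixes k :: nat and D :: "nat \<Rightarrow> real set"
  assumes "k \<ge> 1" "\<And>i. i < k \<Longrightarrow> bounded (D i)" "\<And>i. i < k \<Longrightarrow> D i \<in> sets borel"
    and "disjoint_family_on D {..<k}"
  defines "F \<equiv> \<lambda>x. indicator (\<Pi>\<^sub>E i\<in>{..<k}. D i) x *\<^sub>R
    Determinant.det (Matrix.mat k k (\<lambda>(i, j). K (x i) (x j)))"
  shows "integrable P (\<lambda>X. \<Prod>i<k. count_in (D i) X)"
    and "integrable (\<Pi>\<^sub>M i\<in>{..<k}. lborel) F"
    and "complex_of_real (LINT X|P. (\<Prod>i<k. count_in (D i) X)) = (LINT x|(\<Pi>\<^sub>M i\<in>{..<k}. lborel). F x)"
proof -
  have *: "(\<forall>i<k. bounded (D i) \<and> D i \<in> sets borel) \<and> disjoint_family_on D {..<k}"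
    using assms by blast
  note det[unfolded determinantal_def, THEN conjunct2, THEN conjunct2, THEN spec, THEN mp,
      OF \<open>k \<ge> 1\<close>, THEN spec, THEN mp, OF *]
  then show "integrable P (\<lambda>X. \<Prod>i<k. count_in (D i) X)"
    and "integrable (\<Pi>\<^sub>M i\<in>{..<k}. lborel) F"
    and "complex_of_real (LINT X|P. (\<Prod>i<k. count_in (D i) X)) = (LINT x|(\<Pi>\<^sub>M i\<in>{..<k}. lborel). F x)"
    unfolding count_in_def F_def set_integrable_def set_lebesgue_integral_def by blast+
qed

lemma first_moment:
  assumes "bounded D" and D[measurable]: "D \<in> sets borel"
  shows "integrable P (count_in D)" "set_integrable lborel D (\<lambda>x. K x x)"
    "(LINT x:D|lborel. K x x) = complex_of_real (mean_count D)"
proof -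
  let ?P = "\<Pi>\<^sub>M i\<in>{..<1::nat}. (lborel :: real measure)"
  let ?G = "\<lambda>x. indicator D x *\<^sub>R K x x"
  note jm = joint_moment[of 1 "\<lambda>_. D", unfolded det_mat_one]
  have dis: "disjoint_family_on (\<lambda>_. D) {..<1::nat}" by (auto simp: disjoint_family_on_def)
  have F: "indicator (\<Pi>\<^sub>E i\<in>{..<1}. D) x *\<^sub>R K (x 0) (x 0) = ?G (x 0)"
    if "x \<in> space ?P" for x
    using that by (auto simp: indicator_def space_PiM PiE_iff)
  have f: "(\<lambda>x. x 0) \<in> ?P \<rightarrow>\<^sub>M lborel" by (intro measurable_component_singleton) auto
  have G[measurable]: "?G \<in> borel_measurable lborel" by measurable
  show "integrable P (count_in D)" using jm(1) assms dis by simp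
  have "integrable ?P (\<lambda>x. ?G (x 0))"
    using jm(2) assms dis by (subst (asm) Bochner_Integration.integrable_cong[OF refl F]) auto
  then have "integrable (distr ?P lborel (\<lambda>x. x 0)) ?G"
    by (subst integrable_distr_eq[OF f G])
  then show "set_integrable lborel D (\<lambda>x. K x x)"
    unfolding distr_PiM_one set_integrable_def .
  have "complex_of_real (mean_count D) = (LINT x|?P. indicator (\<Pi>\<^sub>E i\<in>{..<1}. D) x *\<^sub>R K (x 0) (x 0))"
    using jm(3) assms dis by (simp add: mean_count_def)
  also have "\<dots> = (LINT x|?P. ?G (x 0))" by (rule Bochner_Integration.integral_cong[OF refl F])
  also have "\<dots> = (LINT x|distr ?P lborel (\<lambda>x. x 0). ?G x)"
    by (rule integral_distr[OF f G, symmetric])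
  finally show "(LINT x:D|lborel. K x x) = complex_of_real (mean_count D)"
    unfolding distr_PiM_one set_lebesgue_integral_def by simp
qed

text \<open>The sign \<open>s\<close> is kept as a number because it enters the second moments as a factor.\<close>

definition half_line :: "real \<Rightarrow> real set \<Rightarrow> bool" where
  "half_line s D \<longleftrightarrow> \<bar>s\<bar> = 1 \<and> (\<forall>x\<in>D. sgn x = s)"

text \<open>On \<open>D \<times> E\<close> the determinant is \<open>K(x, x) K(y, y) - s t |K(x, y)|\<^sup>2\<close>. Since the determinant and the
diagonal term are integrable, so is \<open>|K|\<^sup>2\<close>: local square integrability of the kernel off the
diagonal comes from the process itself.\<close>

lemma product_moment:
  assumes bd: "bounded D" "bounded E" and D[measurable]: "D \<in> sets borel" and E[measurable]: "E \<in> sets borel"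
    and "D \<inter> E = {}" and half: "half_line s D" "half_line t E"
  shows "integrable P (\<lambda>X. count_in D X * count_in E X)" "emeasure rho (D \<times> E) < \<infinity>"
    "expectation (\<lambda>X. count_in D X * count_in E X) = mean_count D * mean_count E - s * t * measure rho (D \<times> E)"
proof -
  let ?P = "\<Pi>\<^sub>M i\<in>{..<2::nat}. (lborel :: real measure)"
  let ?L = "lborel \<Otimes>\<^sub>M (lborel :: real measure)"
  let ?f = "\<lambda>x::nat \<Rightarrow> real. (x 0, x 1)"
  define G where "G z = indicator (D \<times> E) z *\<^sub>R
    (K (fst z) (fst z) * K (snd z) (snd z) - K (fst z) (snd z) * K (snd z) (fst z))" for z
  define H where "H z = indicator (D \<times> E) z *\<^sub>R (K (fst z) (fst z) * K (snd z) (snd z))" for z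
  define Q where "Q z = indicator (D \<times> E) z * (cmod (K (fst z) (snd z)))\<^sup>2" for z
  have G[measurable]: "G \<in> borel_measurable ?L" unfolding G_def[abs_def] by measurable
  have H[measurable]: "H \<in> borel_measurable ?L" unfolding H_def[abs_def] by measurable
  have Q[measurable]: "Q \<in> borel_measurable ?L" unfolding Q_def[abs_def] by measurable
  let ?D = "\<lambda>i::nat. if i = 0 then D else E"
  note jm = joint_moment[of 2 ?D, unfolded det_mat_two]
  have dis: "disjoint_family_on ?D {..<2::nat}"
    using \<open>D \<inter> E = {}\<close> by (auto simp: disjoint_family_on_def)
  have F: "indicator (\<Pi>\<^sub>E i\<in>{..<2}. ?D i) x *\<^sub>R (K (x 0) (x 0) * K (x 1) (x 1) - K (x 0) (x 1) * K (x 1) (x 0))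
      = G (?f x)"
    if "x \<in> space ?P" for x
  proof -
    have "x \<in> (\<Pi>\<^sub>E i\<in>{..<2}. ?D i) \<longleftrightarrow> ?f x \<in> D \<times> E"
      using that by (auto simp: space_PiM PiE_iff less_2_cases_iff)
    then show ?thesis by (simp add: G_def indicator_def)
  qed
  have f: "?f \<in> ?P \<rightarrow>\<^sub>M ?L" by (intro measurable_Pair measurable_component_singleton) auto
  have prod: "(\<Prod>i<2. count_in (?D i) X) = count_in D X * count_in E X" for X by (simp add: numeral_2_eq_2)
  show "integrable P (\<lambda>X. count_in D X * count_in E X)"
    using jm(1) bd D E dis unfolding prod by simp
  have "integrable ?P (\<lambda>x. G (?f x))"
    using jm(2) bd D E dis by (subst (asm) Bochner_Integration.integrable_cong[OF refl F]) auto
  then have "integrable (distr ?P ?L ?f) G" by (subst integrable_distr_eq[OF f G])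
  then have Gi: "integrable ?L G" unfolding distr_PiM_two .
  have "complex_of_real (expectation (\<lambda>X. count_in D X * count_in E X)) = (LINT x|?P. indicator (\<Pi>\<^sub>E i\<in>{..<2}. ?D i) x *\<^sub>R
      (K (x 0) (x 0) * K (x 1) (x 1) - K (x 0) (x 1) * K (x 1) (x 0)))"
    using jm(3) bd D E dis unfolding prod by simp
  also have "\<dots> = (LINT x|?P. G (?f x))" by (rule Bochner_Integration.integral_cong[OF refl F])
  also have "\<dots> = (LINT x|distr ?P ?L ?f. G x)" by (rule integral_distr[OF f G, symmetric])
  finally have GE: "complex_of_real (expectation (\<lambda>X. count_in D X * count_in E X)) = (LINT z|?L. G z)"
    unfolding distr_PiM_two .
  have iD: "integrable lborel (\<lambda>x. indicator D x *\<^sub>R K x x)" and iE: "integrable lborel (\<lambda>x. indicator E x *\<^sub>R K x x)"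
    using first_moment(2)[of D] first_moment(2)[of E] bd by (auto simp: set_integrable_def)
  have Hprod: "H (x, y) = (indicator D x *\<^sub>R K x x) * (indicator E y *\<^sub>R K y y)" for x y
    by (auto simp: H_def indicator_def)
  have Hi: "integrable ?L H"
  proof (rule lborel_pair.Fubini_integrable[OF H])
    show "integrable lborel (\<lambda>x. LINT y|lborel. norm (H (x, y)))"
      unfolding Hprod norm_mult integral_mult_right_zero
      by (intro integrable_mult_left integrable_norm iD)
    show "AE x in lborel. integrable lborel (\<lambda>y. H (x, y))"
      unfolding Hprod by (intro AE_I2 integrable_mult_right iE)
  qed
  have "(LINT z|?L. H z) =
      (LINT x|lborel. LINT y|lborel. (indicator D x *\<^sub>R K x x) * (indicator E y *\<^sub>R K y y))"
    unfolding lborel_pair.integral_fst'[OF Hi, symmetric] Hprod ..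
  also have "\<dots> = (LINT x|lborel. indicator D x *\<^sub>R K x x) * (LINT y|lborel. indicator E y *\<^sub>R K y y)"
    by (simp only: integral_mult_right_zero integral_mult_left_zero)
  also have "\<dots> = complex_of_real (mean_count D * mean_count E)"
    using first_moment(3)[of D] first_moment(3)[of E] bd by (simp add: set_lebesgue_integral_def)
  finally have HE: "(LINT z|?L. H z) = complex_of_real (mean_count D * mean_count E)" .
  have st: "s * s = 1" "t * t = 1" "s * t * (s * t) = 1"
    using half by (auto simp: half_line_def abs_if split: if_splits)
  have GHQ: "G z = H z - complex_of_real (s * t * Q z)" for z
  proof (cases "z \<in> D \<times> E")
    case True
    then have sg: "sgn (fst z) = s" "sgn (snd z) = t" "fst z \<noteq> 0" "snd z \<noteq> 0"
      using half by (auto simp: half_line_def)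
    have "K (snd z) (fst z) = complex_of_real (sgn (snd z) * sgn (fst z)) * cnj (K (fst z) (snd z))"
      using J sg(3,4) unfolding J_hermitian_def by blast
    then have "K (fst z) (snd z) * K (snd z) (fst z) = complex_of_real (s * t) * (K (fst z) (snd z) * cnj (K (fst z) (snd z)))"
      by (simp add: sg)
    also have "\<dots> = complex_of_real (s * t * Q z)"
      using True by (simp add: Q_def complex_norm_square[symmetric])
    finally show ?thesis using True by (simp add: G_def H_def)
  qed (simp add: G_def H_def Q_def)
  have Q_eq: "Q = (\<lambda>z. s * t * Re (H z - G z))"
    unfolding GHQ using st(3) by (simp add: fun_eq_iff mult.assoc[symmetric])
  have Qi: "integrable ?L Q"
    unfolding Q_eq using Hi Gi
    by (intro integrable_mult_right integrable_Re Bochner_Integration.integrable_diff)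
  have rho: "emeasure rho (D \<times> E) = ennreal (LINT z|?L. Q z)"
  proof -
    have "emeasure rho (D \<times> E) = (\<integral>\<^sup>+z. ennreal (Q z) \<partial>?L)"
      by (subst emeasure_kernel_measure) (auto simp: Q_def indicator_def split_beta intro!: nn_integral_cong)
    also have "\<dots> = ennreal (LINT z|?L. Q z)"
      by (rule nn_integral_eq_integral[OF Qi]) (simp add: Q_def)
    finally show ?thesis .
  qed
  then show "emeasure rho (D \<times> E) < \<infinity>" by simp
  have "measure rho (D \<times> E) = (LINT z|?L. Q z)"
    using rho by (simp add: measure_def Q_def)
  moreover have "(LINT z|?L. G z) = (LINT z|?L. H z) - complex_of_real (s * t * (LINT z|?L. Q z))"
    unfolding GHQ using Hi Qi by simp
  ultimately have "complex_of_real (expectation (\<lambda>X. count_in D X * count_in E X))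
      = complex_of_real (mean_count D * mean_count E - s * t * measure rho (D \<times> E))"
    using GE HE by simp
  then show "expectation (\<lambda>X. count_in D X * count_in E X) = mean_count D * mean_count E - s * t * measure rho (D \<times> E)"
    using of_real_eq_iff by blast
qed

end

text \<open>The correlation formula is available only for disjoint sets. Pairs of points that lie in different
dyadic cells of level \<open>n\<close> are counted by products over disjoint cells, and these pairs exhaust all pairs of
distinct points as \<open>n \<rightarrow> \<infinity>\<close>.\<close>

definition dyadic_separated :: "nat \<Rightarrow> (real \<times> real) set" where
  "dyadic_separated n = {z. \<lfloor>2^n * fst z\<rfloor> \<noteq> \<lfloor>2^n * snd z\<rfloor>}"

lemma dyadic_separated_measurable [measurable]: "dyadic_separated n \<in> sets (lborel \<Otimes>\<^sub>M lborel)"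
proof -
  have "Measurable.pred (lborel \<Otimes>\<^sub>M lborel) (\<lambda>z. \<lfloor>2^n * (fst z :: real)\<rfloor> \<noteq> \<lfloor>2^n * (snd z :: real)\<rfloor>)"
    by measurable
  then show ?thesis
    unfolding pred_def dyadic_separated_def by (simp add: space_pair_measure)
qed

lemma incseq_dyadic_separated: "incseq dyadic_separated"
proof (rule incseq_SucI)
  fix n
  have half: "\<lfloor>2^n * x\<rfloor> = \<lfloor>2^Suc n * x\<rfloor> div 2" for x :: real
    using floor_divide_real_eq_div[of 2 "2^Suc n * x"] by simp
  show "dyadic_separated n \<subseteq> dyadic_separated (Suc n)"
    unfolding dyadic_separated_def by (auto simp only: half)
qed

lemma Union_dyadic_separated: "(\<Union>n. dyadic_separated n) = {z. fst z \<noteq> snd z}"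
proof -
  have "\<exists>n. \<lfloor>2^n * x\<rfloor> \<noteq> \<lfloor>2^n * y\<rfloor>" if "x < y" for x y :: real
  proof -
    obtain n where "1 / (y - x) < 2^n" using real_arch_pow[of 2 "1 / (y - x)"] by auto
    then have "2^n * x + 1 \<le> 2^n * y" using that by (simp add: field_simps)
    then have "\<lfloor>2^n * x\<rfloor> + 1 \<le> \<lfloor>2^n * y\<rfloor>" by (metis floor_add_int floor_mono of_int_1)
    then show ?thesis by (intro exI[of _ n]) linarith
  qed
  then have "\<exists>n. \<lfloor>2^n * x\<rfloor> \<noteq> \<lfloor>2^n * y\<rfloor>" if "x \<noteq> y" for x y :: real
    using that by (metis linorder_neqE)
  then show ?thesis by (auto simp: dyadic_separated_def)
qed

context hermitian_process
begin

lemma half_line_subset: "half_line s E \<Longrightarrow> D \<subseteq> E \<Longrightarrow> half_line s D"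
  by (auto simp: half_line_def)

lemma half_line_square: "half_line s D \<Longrightarrow> s * s = 1"
  by (auto simp: half_line_def abs_if split: if_splits)

lemma mean_count_nonneg: "mean_count D \<ge> 0"
  unfolding mean_count_def count_in_def by (rule Bochner_Integration.integral_nonneg) simp

lemma count_in_Union:
  assumes "X \<in> Conf" "finite I" "\<And>k. k \<in> I \<Longrightarrow> bounded (C k)" "disjoint_family_on C I"
  shows "count_in (\<Union>k\<in>I. C k) X = (\<Sum>k\<in>I. count_in (C k) X)"
proof -
  have "X \<inter> (\<Union>k\<in>I. C k) = (\<Union>k\<in>I. X \<inter> C k)" by auto
  also have "card \<dots> = (\<Sum>k\<in>I. card (X \<inter> C k))"
    using assms by (intro card_UN_disjoint) (auto simp: disjoint_family_on_def intro: Conf_finite)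
  finally show ?thesis by (simp add: count_in_def)
qed

text \<open>Summing \<open>product_moment\<close> over the pairs of different cells expresses the left-hand side as a sum
of products of means over distinct cells, which is part of the expansion of the square of
the total mean.\<close>

lemma separated_pairs_moment:
  fixes n :: nat
  assumes bd: "bounded D" and D[measurable]: "D \<in> sets borel" and half: "half_line s D"
  defines "a \<equiv> \<lambda>X. ennreal (real (card ((X \<inter> D) \<times> (X \<inter> D) \<inter> dyadic_separated n)))"
  shows "a \<in> borel_measurable P"
    and "(\<integral>\<^sup>+X. a X \<partial>P) + emeasure rho (D \<times> D \<inter> dyadic_separated n) \<le> ennreal ((mean_count D)\<^sup>2)"
proof -
  obtain b where b: "\<And>x. x \<in> D \<Longrightarrow> \<bar>x\<bar> \<le> b" using bd by (auto simp: bounded_iff)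
  define I where "I = {\<lfloor>2^n * (-b)\<rfloor> .. \<lfloor>2^n * b\<rfloor>}"
  define C where "C k = D \<inter> {x. \<lfloor>2^n * x\<rfloor> = k}" for k
  define J where "J = {p \<in> I \<times> I. fst p \<noteq> snd p}"
  have fin: "finite I" "finite J" by (auto simp: I_def J_def)
  have CD: "C k \<subseteq> D" for k by (auto simp: C_def)
  have Cb: "bounded (C k)" for k using bd CD bounded_subset by blast
  have [measurable]: "C k \<in> sets borel" for k unfolding C_def by measurable
  have Ch: "half_line s (C k)" for k using half CD by (rule half_line_subset)
  have Cdis: "k \<noteq> l \<Longrightarrow> C k \<inter> C l = {}" for k l by (auto simp: C_def)
  have Ck: "x \<in> C k \<Longrightarrow> x \<in> C l \<Longrightarrow> k = l" for x k l by (auto simp: C_def)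
  have I: "x \<in> D \<Longrightarrow> \<lfloor>2^n * x\<rfloor> \<in> I" for x
    using b[of x] unfolding I_def atLeastAtMost_iff
    by (intro conjI floor_mono mult_left_mono) auto
  have DC: "D = (\<Union>k\<in>I. C k)" using I by (auto simp: C_def)
  have sep: "D \<times> D \<inter> dyadic_separated n = (\<Union>p\<in>J. C (fst p) \<times> C (snd p))"
    using I by (force simp: J_def C_def dyadic_separated_def)
  have Jdis: "disjoint_family_on (\<lambda>p. C (fst p) \<times> C (snd p)) J"
    using Cdis by (fastforce simp: disjoint_family_on_def C_def)
  have pm: "integrable P (\<lambda>X. count_in (C (fst p)) X * count_in (C (snd p)) X)"
    "emeasure rho (C (fst p) \<times> C (snd p)) < \<infinity>"
    "expectation (\<lambda>X. count_in (C (fst p)) X * count_in (C (snd p)) X) =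
      mean_count (C (fst p)) * mean_count (C (snd p)) - measure rho (C (fst p) \<times> C (snd p))" if "p \<in> J" for p
    using product_moment[OF Cb Cb _ _ Cdis Ch Ch, of "fst p" "snd p"] that half_line_square[OF half]
    by (auto simp: J_def)
  have a: "a X = ennreal (\<Sum>p\<in>J. count_in (C (fst p)) X * count_in (C (snd p)) X)" if X: "X \<in> Conf" for X
  proof -
    have "(X \<inter> D) \<times> (X \<inter> D) \<inter> dyadic_separated n = (\<Union>p\<in>J. (X \<inter> C (fst p)) \<times> (X \<inter> C (snd p)))"
      using sep by auto
    also have "card \<dots> = (\<Sum>p\<in>J. card ((X \<inter> C (fst p)) \<times> (X \<inter> C (snd p))))"
      using fin X Cb
      by (intro card_UN_disjoint) (auto intro!: Conf_finite dest: Ck)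
    finally show ?thesis by (simp add: a_def count_in_def card_cartesian_product)
  qed
  have [measurable]: "count_in (C k) \<in> borel_measurable P" for k by (intro count_in_measurable Cb) simp
  show "a \<in> borel_measurable P"
    by (subst measurable_cong[OF a]) (auto simp: space_P)
  have "(\<integral>\<^sup>+X. a X \<partial>P) = (\<integral>\<^sup>+X. ennreal (\<Sum>p\<in>J. count_in (C (fst p)) X * count_in (C (snd p)) X) \<partial>P)"
    by (intro nn_integral_cong a) (simp add: space_P)
  also have "\<dots> = ennreal (expectation (\<lambda>X. \<Sum>p\<in>J. count_in (C (fst p)) X * count_in (C (snd p)) X))"
    by (intro nn_integral_eq_integral Bochner_Integration.integrable_sum pm(1)) (auto simp: count_in_def sum_nonneg)
  finally have 1: "(\<integral>\<^sup>+X. a X \<partial>P) = ennreal (\<Sum>p\<in>J. expectation (\<lambda>X. count_in (C (fst p)) X * count_in (C (snd p)) X))"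
    using pm(1) by (subst (asm) Bochner_Integration.integral_sum) auto
  have "emeasure rho (D \<times> D \<inter> dyadic_separated n) = (\<Sum>p\<in>J. emeasure rho (C (fst p) \<times> C (snd p)))"
    unfolding sep using Jdis fin by (intro sum_emeasure[symmetric]) auto
  also have "\<dots> = (\<Sum>p\<in>J. ennreal (measure rho (C (fst p) \<times> C (snd p))))"
    using pm(2) by (intro sum.cong refl emeasure_eq_ennreal_measure) (simp add: less_top)
  also have "\<dots> = ennreal (\<Sum>p\<in>J. measure rho (C (fst p) \<times> C (snd p)))"
    by (rule sum_ennreal) simp
  finally have 2: "emeasure rho (D \<times> D \<inter> dyadic_separated n) = ennreal (\<Sum>p\<in>J. measure rho (C (fst p) \<times> C (snd p)))" .
  have "expectation (\<lambda>X. count_in (C (fst p)) X * count_in (C (snd p)) X) \<ge> 0" for p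
    by (rule Bochner_Integration.integral_nonneg) (simp add: count_in_def)
  then have "(\<integral>\<^sup>+X. a X \<partial>P) + emeasure rho (D \<times> D \<inter> dyadic_separated n) =
      ennreal ((\<Sum>p\<in>J. expectation (\<lambda>X. count_in (C (fst p)) X * count_in (C (snd p)) X)) +
        (\<Sum>p\<in>J. measure rho (C (fst p) \<times> C (snd p))))"
    unfolding 1 2 by (intro ennreal_plus[symmetric] sum_nonneg) auto
  also have "\<dots> = ennreal (\<Sum>p\<in>J. mean_count (C (fst p)) * mean_count (C (snd p)))"
    using pm(3) by (simp flip: sum.distrib)
  also have "\<dots> \<le> ennreal (\<Sum>p\<in>I \<times> I. mean_count (C (fst p)) * mean_count (C (snd p)))"
    using fin mean_count_nonneg by (intro ennreal_leI sum_mono2) (auto simp: J_def)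
  also have "(\<Sum>p\<in>I \<times> I. mean_count (C (fst p)) * mean_count (C (snd p))) = (\<Sum>k\<in>I. mean_count (C k))\<^sup>2"
    by (simp add: power2_eq_square sum_product sum.cartesian_product split_beta)
  also have "(\<Sum>k\<in>I. mean_count (C k)) = mean_count D"
  proof -
    have "mean_count D = expectation (\<lambda>X. \<Sum>k\<in>I. count_in (C k) X)"
      unfolding mean_count_def
    proof (rule Bochner_Integration.integral_cong[OF refl])
      fix X assume "X \<in> space P"
      then have "count_in (\<Union>k\<in>I. C k) X = (\<Sum>k\<in>I. count_in (C k) X)"
        using fin Cb Cdis by (intro count_in_Union) (auto simp: space_P disjoint_family_on_def)
      then show "count_in D X = (\<Sum>k\<in>I. count_in (C k) X)" using DC by simp
    qed
    also have "\<dots> = (\<Sum>k\<in>I. mean_count (C k))"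
      unfolding mean_count_def by (intro Bochner_Integration.integral_sum first_moment(1) Cb) simp
    finally show ?thesis by simp
  qed
  finally show "(\<integral>\<^sup>+X. a X \<partial>P) + emeasure rho (D \<times> D \<inter> dyadic_separated n) \<le> ennreal ((mean_count D)\<^sup>2)" .
qed

text \<open>The diagonal is a null set of the plane.\<close>

lemma rho_offdiagonal:
  assumes [measurable]: "S \<in> sets (lborel \<Otimes>\<^sub>M lborel)"
  shows "emeasure rho (S \<inter> {z. fst z \<noteq> snd z}) = emeasure rho S"
proof -
  have off: "{z. fst z \<noteq> (snd z :: real)} \<in> sets (lborel \<Otimes>\<^sub>M lborel)"
    unfolding Union_dyadic_separated[symmetric] by (intro sets.countable_UN image_subsetI dyadic_separated_measurable)
  have "AE x in lborel. AE y in lborel. x \<noteq> (y::real)"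
  proof (rule AE_I2)
    show "AE y in lborel. x \<noteq> y" for x :: real
      using AE_lborel_singleton[of x] by eventually_elim auto
  qed
  then have "AE z in lborel \<Otimes>\<^sub>M lborel. fst z \<noteq> (snd z :: real)"
    by (intro lborel_pair.AE_pair_measure) (use off in \<open>auto simp: split_beta space_pair_measure\<close>)
  then have "(\<integral>\<^sup>+z. ennreal ((cmod (case_prod K z))\<^sup>2) * indicator (S \<inter> {z. fst z \<noteq> snd z}) z \<partial>(lborel \<Otimes>\<^sub>M lborel))
    = (\<integral>\<^sup>+z. ennreal ((cmod (case_prod K z))\<^sup>2) * indicator S z \<partial>(lborel \<Otimes>\<^sub>M lborel))"
    by (intro nn_integral_cong_AE, eventually_elim) (auto simp: indicator_def)
  then show ?thesis
    unfolding emeasure_kernel_measure[OF K_meas assms] emeasure_kernel_measure[OF K_meas sets.Int[OF assms off]] .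
qed

text \<open>The limit \<open>n \<rightarrow> \<infinity>\<close> in \<open>separated_pairs_moment\<close>: the number of ordered pairs of distinct points is
\<open>c\<^sup>2 - c\<close> for a count \<open>c\<close>. The upper bound for the second moment suffices, since only upper bounds for
variances are needed.\<close>

lemma square_moment:
  assumes bd: "bounded D" and D[measurable]: "D \<in> sets borel" and half: "half_line s D"
  shows "integrable P (\<lambda>X. count_in D X * count_in D X)" "emeasure rho (D \<times> D) < \<infinity>"
    "expectation (\<lambda>X. count_in D X * count_in D X) \<le> mean_count D + mean_count D * mean_count D - measure rho (D \<times> D)"
proof -
  define a where "a n X = ennreal (real (card ((X \<inter> D) \<times> (X \<inter> D) \<inter> dyadic_separated n)))" for n X
  note sp = separated_pairs_moment[OF assms, folded a_def]
  have [measurable]: "count_in D \<in> borel_measurable P" by (intro count_in_measurable bd D)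
  have inc: "incseq (\<lambda>n. A \<inter> dyadic_separated n)" for A
    using incseq_dyadic_separated by (fastforce simp: incseq_def)
  have ainc: "a n X \<le> a k X" if "X \<in> Conf" "n \<le> k" for n k X
  proof -
    have "(X \<inter> D) \<times> (X \<inter> D) \<inter> dyadic_separated n \<subseteq> (X \<inter> D) \<times> (X \<inter> D) \<inter> dyadic_separated k"
      using incseq_dyadic_separated \<open>n \<le> k\<close> by (auto simp: incseq_def)
    then show ?thesis
      unfolding a_def using Conf_finite[OF that(1) bd] by (intro ennreal_leI) (auto intro!: card_mono)
  qed
  have aSUP: "(SUP n. a n X) = ennreal (count_in D X * count_in D X - count_in D X)" if X: "X \<in> Conf" for X
  proof -
    let ?F = "X \<inter> D"
    have fin: "finite ?F" using Conf_finite[OF X bd] .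
    have "(SUP n. a n X) = (SUP n. emeasure (count_space UNIV) (?F \<times> ?F \<inter> dyadic_separated n))"
      using fin by (simp add: a_def ennreal_of_nat_eq_real_of_nat)
    also have "\<dots> = emeasure (count_space UNIV) (\<Union>n. ?F \<times> ?F \<inter> dyadic_separated n)"
      by (intro SUP_emeasure_incseq inc) auto
    also have "(\<Union>n. ?F \<times> ?F \<inter> dyadic_separated n) = ?F \<times> ?F - (\<lambda>x. (x, x)) ` ?F"
      using Union_dyadic_separated by auto
    also have "emeasure (count_space UNIV) \<dots> = ennreal (real (card (?F \<times> ?F - (\<lambda>x. (x, x)) ` ?F)))"
      using fin by (simp add: ennreal_of_nat_eq_real_of_nat)
    also have "card (?F \<times> ?F - (\<lambda>x. (x, x)) ` ?F) = card (?F \<times> ?F) - card ((\<lambda>x. (x, x)) ` ?F)"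
      using fin by (intro card_Diff_subset) auto
    also have "\<dots> = card ?F * card ?F - card ?F"
      by (simp add: card_cartesian_product card_image inj_on_def)
    also have "real \<dots> = count_in D X * count_in D X - count_in D X"
      by (simp add: count_in_def of_nat_diff)
    finally show ?thesis .
  qed
  have "(\<lambda>n. \<integral>\<^sup>+X. a n X \<partial>P) \<longlonglongrightarrow> (SUP n. \<integral>\<^sup>+X. a n X \<partial>P)"
    by (rule LIMSEQ_SUP) (auto simp: incseq_def space_P intro!: nn_integral_mono ainc)
  also have "(SUP n. \<integral>\<^sup>+X. a n X \<partial>P) = (\<integral>\<^sup>+X. (SUP n. a n X) \<partial>P)"
    by (rule nn_integral_monotone_convergence_SUP_AE[symmetric]) (auto simp: space_P sp(1) intro!: AE_I2 ainc)
  also have "\<dots> = (\<integral>\<^sup>+X. ennreal (count_in D X * count_in D X - count_in D X) \<partial>P)"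
    by (intro nn_integral_cong aSUP) (simp add: space_P)
  finally have 1: "(\<lambda>n. \<integral>\<^sup>+X. a n X \<partial>P) \<longlonglongrightarrow> (\<integral>\<^sup>+X. ennreal (count_in D X * count_in D X - count_in D X) \<partial>P)" .
  have "(\<lambda>n. emeasure rho (D \<times> D \<inter> dyadic_separated n)) \<longlonglongrightarrow> emeasure rho (\<Union>n. D \<times> D \<inter> dyadic_separated n)"
  proof (intro Lim_emeasure_incseq inc image_subsetI)
    show "D \<times> D \<inter> dyadic_separated n \<in> sets rho" for n by measurable
  qed
  also have "(\<Union>n. D \<times> D \<inter> dyadic_separated n) = D \<times> D \<inter> {z. fst z \<noteq> snd z}"
    using Union_dyadic_separated by auto
  also have "emeasure rho \<dots> = emeasure rho (D \<times> D)" by (rule rho_offdiagonal) simp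
  finally have 2: "(\<lambda>n. emeasure rho (D \<times> D \<inter> dyadic_separated n)) \<longlonglongrightarrow> emeasure rho (D \<times> D)" .
  have le: "(\<integral>\<^sup>+X. ennreal (count_in D X * count_in D X - count_in D X) \<partial>P) + emeasure rho (D \<times> D) \<le> ennreal ((mean_count D)\<^sup>2)"
    using sp(2) by (intro LIMSEQ_le_const2[OF tendsto_add[OF 1 2]]) auto
  have "emeasure rho (D \<times> D) \<le> (\<integral>\<^sup>+X. ennreal (count_in D X * count_in D X - count_in D X) \<partial>P) + emeasure rho (D \<times> D)"
    by (rule add_increasing) simp_all
  also note le
  finally show fin: "emeasure rho (D \<times> D) < \<infinity>"
    unfolding infinity_ennreal_def by (rule le_less_trans[OF _ ennreal_less_top])
  have nonneg: "0 \<le> count_in D X * count_in D X - count_in D X" for X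
    unfolding count_in_def by (cases "card (X \<inter> D)") (auto simp: algebra_simps)
  have int: "integrable P (\<lambda>X. count_in D X * count_in D X - count_in D X)"
  proof (rule integrableI_bounded)
    have "(\<integral>\<^sup>+X. ennreal (count_in D X * count_in D X - count_in D X) \<partial>P)
        \<le> (\<integral>\<^sup>+X. ennreal (count_in D X * count_in D X - count_in D X) \<partial>P) + emeasure rho (D \<times> D)"
      by (rule add_increasing2) simp_all
    also note le
    finally have "(\<integral>\<^sup>+X. ennreal (count_in D X * count_in D X - count_in D X) \<partial>P) < \<infinity>"
      unfolding infinity_ennreal_def by (rule le_less_trans[OF _ ennreal_less_top])
    then show "(\<integral>\<^sup>+X. ennreal (norm (count_in D X * count_in D X - count_in D X)) \<partial>P) < \<infinity>"
      using nonneg by simp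
  qed simp
  then have "integrable P (\<lambda>X. (count_in D X * count_in D X - count_in D X) + count_in D X)"
    by (intro Bochner_Integration.integrable_add first_moment(1) bd D)
  then show "integrable P (\<lambda>X. count_in D X * count_in D X)" by simp
  have "ennreal (expectation (\<lambda>X. count_in D X * count_in D X - count_in D X) + measure rho (D \<times> D)) \<le> ennreal ((mean_count D)\<^sup>2)"
    using le fin nonneg
    by (subst ennreal_plus) (auto simp: nn_integral_eq_integral[OF int] emeasure_eq_ennreal_measure less_top)
  then have "expectation (\<lambda>X. count_in D X * count_in D X - count_in D X) + measure rho (D \<times> D) \<le> mean_count D * mean_count D"
    by (subst (asm) ennreal_le_iff) (auto simp: power2_eq_square)
  moreover have "expectation (\<lambda>X. count_in D X * count_in D X - count_in D X) = expectation (\<lambda>X. count_in D X * count_in D X) - mean_count D"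
    unfolding mean_count_def using \<open>integrable P (\<lambda>X. count_in D X * count_in D X)\<close>
    by (intro Bochner_Integration.integral_diff first_moment(1) bd D)
  ultimately show "expectation (\<lambda>X. count_in D X * count_in D X) \<le> mean_count D + mean_count D * mean_count D - measure rho (D \<times> D)" by simp
qed

text \<open>Split the larger set into the smaller one and the rest, and combine \<open>square_moment\<close> with
\<open>product_moment\<close>.\<close>

lemma nested_moment:
  assumes DE: "D \<subseteq> E" and bd: "bounded E" and D[measurable]: "D \<in> sets borel" and E[measurable]: "E \<in> sets borel"
    and half: "half_line s E"
  shows "integrable P (\<lambda>X. count_in D X * count_in E X)" "emeasure rho (D \<times> E) < \<infinity>"
    "expectation (\<lambda>X. count_in D X * count_in E X) \<le> mean_count D + mean_count D * mean_count E - measure rho (D \<times> E)"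
proof -
  let ?R = "E - D"
  have bdD: "bounded D" "bounded ?R" using bd DE bounded_subset by blast+
  have h: "half_line s D" "half_line s ?R" using half DE by (auto intro: half_line_subset)
  have R[measurable]: "?R \<in> sets borel" by simp
  note sq = square_moment[OF bdD(1) D h(1)]
  note pm = product_moment[OF bdD D R _ h, unfolded half_line_square[OF half]]
  have NE: "count_in E X = count_in D X + count_in ?R X" if "X \<in> space P" for X
  proof -
    have "X \<inter> E = (X \<inter> D) \<union> (X \<inter> ?R)" using DE by auto
    then have "card (X \<inter> E) = card (X \<inter> D) + card (X \<inter> ?R)"
      using that bdD by (simp only:) (intro card_Un_disjoint, auto simp: space_P intro: Conf_finite)
    then show ?thesis by (simp add: count_in_def)
  qed
  have prod: "count_in D X * count_in E X = count_in D X * count_in D X + count_in D X * count_in ?R X" if "X \<in> space P" for X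
    by (simp add: NE[OF that] distrib_left)
  have int: "integrable P (\<lambda>X. count_in D X * count_in D X + count_in D X * count_in ?R X)"
    using sq(1) pm(1) by auto
  then show "integrable P (\<lambda>X. count_in D X * count_in E X)"
    by (subst Bochner_Integration.integrable_cong[OF refl prod])
  have mE: "mean_count E = mean_count D + mean_count ?R"
  proof -
    have "mean_count E = expectation (\<lambda>X. count_in D X + count_in ?R X)"
      unfolding mean_count_def by (intro Bochner_Integration.integral_cong refl NE)
    then show ?thesis
      using first_moment(1)[OF bdD(1) D] first_moment(1)[OF bdD(2) R] by (simp add: mean_count_def)
  qed
  have DxE: "D \<times> E = D \<times> D \<union> D \<times> ?R" "(D \<times> D) \<inter> (D \<times> ?R) = {}" using DE by auto
  have meas: "D \<times> D \<in> sets rho" "D \<times> ?R \<in> sets rho" by measurable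
  have "emeasure rho (D \<times> E) \<le> emeasure rho (D \<times> D) + emeasure rho (D \<times> ?R)"
    unfolding DxE(1) by (rule emeasure_subadditive[OF meas])
  also have "\<dots> < \<infinity>" using sq(2) pm(2) by auto
  finally show "emeasure rho (D \<times> E) < \<infinity>" .
  have "measure rho (D \<times> E) = measure rho (D \<times> D) + measure rho (D \<times> ?R)"
    unfolding DxE(1) using sq(2) pm(2) by (intro measure_Union meas DxE(2)) auto
  moreover have "expectation (\<lambda>X. count_in D X * count_in E X) = expectation (\<lambda>X. count_in D X * count_in D X) + expectation (\<lambda>X. count_in D X * count_in ?R X)"
    using sq(1) pm(1) by (subst Bochner_Integration.integral_cong[OF refl prod]) auto
  ultimately show "expectation (\<lambda>X. count_in D X * count_in E X) \<le> mean_count D + mean_count D * mean_count E - measure rho (D \<times> E)"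
    using sq(3) pm(3) mE by (simp add: algebra_simps)
qed

lemma rho_null: "emeasure rho (D \<times> {0}) = 0" "emeasure rho ({0} \<times> D) = 0" if [measurable]: "D \<in> sets borel"
proof -
  have z: "AE x in lborel. x \<noteq> (0::real)" by (rule AE_lborel_singleton)
  then show "emeasure rho ({0} \<times> D) = 0"
    by (subst emeasure_kernel_measure_Times) (auto simp: nn_integral_0_iff_AE elim!: eventually_mono)
  then show "emeasure rho (D \<times> {0}) = 0"
    by (subst kernel_measure_swap[OF J]) auto
qed

text \<open>For a bounded set \<open>E\<close> on one side of the origin, cover \<open>E \<times> D\<close> by the rectangles \<open>(E \<inter> D) \<times> E\<close>, \<open>E \<times> (D - E)\<close> and \<open>(E - D) \<times> D\<close>: the first one has
nested sides and the other two have disjoint sides, so that the moment lemmas apply to each.\<close>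

lemma rho_finite_bounded:
  assumes "bounded D" "D \<in> sets borel" "half_line s D"
  shows "emeasure rho ({-real n..real n} \<times> D) < \<infinity>"
proof -
  note [measurable] = assms(2)
  let ?p = "{0<..real n}" and ?n = "{-real n..<0}"
  have fin: "emeasure rho (E \<times> D) < \<infinity>" if "E \<in> sets borel" "bounded E" "half_line t E" for E t
  proof -
    note [measurable] = \<open>E \<in> sets borel\<close>
    have h: "half_line t (E \<inter> D)" "half_line t (E - D)" "half_line s (D - E)"
      using that(3) assms(3) by (auto intro: half_line_subset)
    have b: "bounded (E \<inter> D)" "bounded (E - D)" "bounded (D - E)"
      using that(2) assms(1) by (auto intro: bounded_subset)
    have "emeasure rho (E \<times> D) \<le> emeasure rho ((E \<inter> D) \<times> E \<union> (E \<times> (D - E)) \<union> (E - D) \<times> D)"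
      by (intro emeasure_mono) auto
    also have "\<dots> \<le> emeasure rho ((E \<inter> D) \<times> E) + emeasure rho (E \<times> (D - E)) + emeasure rho ((E - D) \<times> D)"
      by (intro order.trans[OF emeasure_subadditive] add_mono emeasure_subadditive order.refl) measurable
    also have "\<dots> < \<infinity>"
      using nested_moment(2)[of "E \<inter> D" E t] product_moment(2)[of E "D - E" t s]
        product_moment(2)[of "E - D" D t s] that assms h b by auto
    finally show ?thesis .
  qed
  have hp: "half_line 1 ?p" "half_line (-1) ?n" by (auto simp: half_line_def)
  have "emeasure rho ({-real n..real n} \<times> D) \<le> emeasure rho (?p \<times> D \<union> ?n \<times> D \<union> {0} \<times> D)"
    by (intro emeasure_mono) auto
  also have "\<dots> \<le> emeasure rho (?p \<times> D) + emeasure rho (?n \<times> D) + emeasure rho ({0} \<times> D)"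
    by (intro order.trans[OF emeasure_subadditive] add_mono emeasure_subadditive order.refl) measurable
  also have "\<dots> < \<infinity>" using fin[OF _ _ hp(1)] fin[OF _ _ hp(2)] by (auto simp: rho_null)
  finally show ?thesis .
qed

end

section \<open>The charge of a symmetric window\<close>

text \<open>The assumption \<open>trace\<close> is the form in which the projection property enters the probabilistic
estimates.\<close>

locale projection_process = hermitian_process +
  assumes trace: "\<And>D s. bounded D \<Longrightarrow> D \<in> sets borel \<Longrightarrow> half_line s D \<Longrightarrow>
    emeasure rho (D \<times> UNIV) = ennreal (mean_count D)"
begin

definition pos_window :: "nat \<Rightarrow> real set" where "pos_window i = {0<..real i}"
definition neg_window :: "nat \<Rightarrow> real set" where "neg_window i = {-real i..<0}"
definition far :: "nat \<Rightarrow> real set" where "far j = {y. real j < \<bar>y\<bar>}"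

definition charge :: "nat \<Rightarrow> real set \<Rightarrow> real" where "charge i X = count_in (pos_window i) X - count_in (neg_window i) X"

text \<open>The part of the mean count in \<open>[-i, i]\<close> that the repulsion inside \<open>[-j, j]\<close> does not compensate.\<close>

definition leakage :: "nat \<Rightarrow> nat \<Rightarrow> real" where "leakage i j = measure rho ({-real i..real i} \<times> far j)"

lemma intervals [measurable, simp]: "pos_window i \<in> sets borel" "neg_window i \<in> sets borel" "far i \<in> sets borel"
  "bounded (pos_window i)" "bounded (neg_window i)" "half_line 1 (pos_window i)" "half_line (-1) (neg_window i)" "pos_window i \<inter> neg_window j = {}" "neg_window i \<inter> pos_window j = {}"
  "i \<le> j \<Longrightarrow> pos_window i \<subseteq> pos_window j" "i \<le> j \<Longrightarrow> neg_window i \<subseteq> neg_window j"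
  by (auto simp: pos_window_def neg_window_def far_def half_line_def)

lemma rho_finite: "emeasure rho ({-real i..real i} \<times> UNIV) < \<infinity>"
proof -
  have "{-real i..real i} \<times> UNIV = pos_window i \<times> UNIV \<union> neg_window i \<times> UNIV \<union> {0} \<times> UNIV"
    by (auto simp: pos_window_def neg_window_def)
  then have "emeasure rho ({-real i..real i} \<times> UNIV) = emeasure rho (pos_window i \<times> UNIV \<union> neg_window i \<times> UNIV \<union> {0} \<times> UNIV)"
    by (rule arg_cong)
  also have "\<dots> \<le> emeasure rho (pos_window i \<times> UNIV) + emeasure rho (neg_window i \<times> UNIV) + emeasure rho ({0} \<times> UNIV)"
    by (intro order.trans[OF emeasure_subadditive] add_mono emeasure_subadditive order.refl) measurable
  also have "\<dots> < \<infinity>" by (simp add: trace[of _ 1] trace[of _ "-1"] rho_null)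
  finally show ?thesis .
qed

lemma rho_fmeasurable:
  "A \<in> sets borel \<Longrightarrow> C \<in> sets borel \<Longrightarrow> A \<subseteq> {-real i..real i} \<Longrightarrow> A \<times> C \<in> fmeasurable rho"
  by (rule fmeasurableI2[OF fmeasurableI[OF _ rho_finite[of i]]]) auto

lemma mean_count_le_rho:
  assumes "half_line s D" and D[measurable]: "D \<in> sets borel" and sub: "D \<subseteq> {-real i..real i}"
  shows "mean_count D \<le> measure rho (D \<times> pos_window j) + measure rho (D \<times> neg_window j) + measure rho (D \<times> far j)"
proof -
  have "bounded D" using sub bounded_closed_interval bounded_subset by blast
  then have "mean_count D = measure rho (D \<times> UNIV)"
    using trace[OF _ D assms(1)] mean_count_nonneg[of D] by (simp add: measure_def)
  also have "D \<times> UNIV = D \<times> pos_window j \<union> D \<times> neg_window j \<union> D \<times> far j \<union> D \<times> {0}"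
    by (auto simp: pos_window_def neg_window_def far_def)
  also have "measure rho \<dots> \<le> measure rho (D \<times> pos_window j) + measure rho (D \<times> neg_window j) + measure rho (D \<times> far j) + measure rho (D \<times> {0})"
    by (intro order.trans[OF measure_Un_le] add_mono measure_Un_le order.refl) measurable
  also have "measure rho (D \<times> {0}) = 0" by (simp add: measure_def rho_null)
  finally show ?thesis by simp
qed

text \<open>The product of two charges has four terms. In each of them the sign of the kernel term cancels the
sign of the charges, so all four rectangles are subtracted from the mean count of the smaller
window, and \<open>mean_count_le_rho\<close> bounds what is left.\<close>

theorem covariance_le_leakage:
  assumes ij: "i \<le> j"
  shows "integrable P (\<lambda>X. charge i X * charge j X)"
    and "expectation (\<lambda>X. charge i X * charge j X) - expectation (charge i) * expectation (charge j) \<le> leakage i j"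
proof -
  note pp = nested_moment[OF intervals(10)[OF ij], of 1, simplified]
  note nn = nested_moment[OF intervals(11)[OF ij], of "-1", simplified]
  note pn = product_moment[of "pos_window i" "neg_window j" 1 "-1", simplified]
  note np = product_moment[of "neg_window i" "pos_window j" "-1" 1, simplified]
  have Zij: "charge i X * charge j X = count_in (pos_window i) X * count_in (pos_window j) X - count_in (pos_window i) X * count_in (neg_window j) X
      - count_in (neg_window i) X * count_in (pos_window j) X + count_in (neg_window i) X * count_in (neg_window j) X" for X
    by (simp add: charge_def algebra_simps)
  show "integrable P (\<lambda>X. charge i X * charge j X)" unfolding Zij using pp nn pn np by auto
  have E: "expectation (\<lambda>X. charge i X * charge j X) = expectation (\<lambda>X. count_in (pos_window i) X * count_in (pos_window j) X) - expectation (\<lambda>X. count_in (pos_window i) X * count_in (neg_window j) X)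
      - expectation (\<lambda>X. count_in (neg_window i) X * count_in (pos_window j) X) + expectation (\<lambda>X. count_in (neg_window i) X * count_in (neg_window j) X)"
    unfolding Zij using pp nn pn np by simp
  have EZ: "expectation (charge i) = mean_count (pos_window i) - mean_count (neg_window i)" for i
    unfolding charge_def[abs_def] mean_count_def by (intro Bochner_Integration.integral_diff first_moment(1)) auto
  have mp: "mean_count (pos_window i) \<le> measure rho (pos_window i \<times> pos_window j) + measure rho (pos_window i \<times> neg_window j) + measure rho (pos_window i \<times> far j)"
    by (rule mean_count_le_rho[OF intervals(6), of _ i]) (auto simp: pos_window_def)
  have mn: "mean_count (neg_window i) \<le> measure rho (neg_window i \<times> pos_window j) + measure rho (neg_window i \<times> neg_window j) + measure rho (neg_window i \<times> far j)"
    by (rule mean_count_le_rho[OF intervals(7), of _ i]) (auto simp: neg_window_def)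
  have fm: "pos_window i \<times> far j \<in> fmeasurable rho" "neg_window i \<times> far j \<in> fmeasurable rho"
    "{-real i..real i} \<times> far j \<in> fmeasurable rho"
    by (auto intro!: rho_fmeasurable[of _ _ i] simp: pos_window_def neg_window_def)
  have "measure rho (pos_window i \<times> far j) + measure rho (neg_window i \<times> far j) = measure rho (pos_window i \<times> far j \<union> neg_window i \<times> far j)"
    using fm by (intro measure_Union[symmetric]) (auto simp: fmeasurable_def pos_window_def neg_window_def)
  also have "\<dots> \<le> leakage i j"
    unfolding leakage_def using fm by (intro measure_mono_fmeasurable) (auto simp: pos_window_def neg_window_def)
  finally have lk: "measure rho (pos_window i \<times> far j) + measure rho (neg_window i \<times> far j) \<le> leakage i j" .
  show "expectation (\<lambda>X. charge i X * charge j X) - expectation (charge i) * expectation (charge j) \<le> leakage i j"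
  proof -
    have "(mean_count (pos_window i) - mean_count (neg_window i)) * (mean_count (pos_window j) - mean_count (neg_window j)) = mean_count (pos_window i) * mean_count (pos_window j) - mean_count (pos_window i) * mean_count (neg_window j)
        - mean_count (neg_window i) * mean_count (pos_window j) + mean_count (neg_window i) * mean_count (neg_window j)"
      by (simp add: algebra_simps)
    then show ?thesis unfolding E EZ using pp(3) nn(3) pn(3) np(3) mp mn lk by linarith
  qed
qed

lemma leakage_tendsto: "(\<lambda>j. leakage i j) \<longlonglongrightarrow> 0"
proof -
  let ?S = "\<lambda>j. {-real i..real i} \<times> far j"
  have "(\<lambda>j. measure rho (?S j)) \<longlonglongrightarrow> measure rho (\<Inter>j. ?S j)"
  proof (rule Lim_measure_decseq)
    show "decseq ?S" by (auto simp: decseq_def far_def)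
    show "emeasure rho (?S j) \<noteq> \<infinity>" for j
      using rho_fmeasurable[of "{-real i..real i}" "far j" i] by (auto simp: fmeasurable_def)
  qed auto
  moreover have "(\<Inter>j. ?S j) = {}"
  proof -
    have "z \<notin> (\<Inter>j. ?S j)" for z
    proof -
      obtain j where "\<bar>snd z\<bar> \<le> real j" using real_arch_simple by blast
      then have "z \<notin> ?S j" by (auto simp: far_def)
      then show ?thesis by blast
    qed
    then show ?thesis by blast
  qed
  ultimately show ?thesis by (simp add: leakage_def)
qed

lemma leakage_mono: "i \<le> i' \<Longrightarrow> j' \<le> j \<Longrightarrow> leakage i j \<le> leakage i' j'"
  unfolding leakage_def
  by (rule measure_mono_fmeasurable) (auto intro!: rho_fmeasurable[of _ _ i'] simp: far_def)

end

section \<open>Averages of nearly uncorrelated variables\<close>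

text \<open>Probability weights supported in the window sizes \<open>R, \<dots>, L - 1\<close>. The upper end \<open>L\<close> is carried along
so that sums are finite.\<close>

definition averaging :: "nat \<Rightarrow> nat \<Rightarrow> (nat \<Rightarrow> real) \<Rightarrow> bool" where
  "averaging R L w \<longleftrightarrow> (\<forall>i. 0 \<le> w i) \<and> (\<forall>i. w i \<noteq> 0 \<longrightarrow> R \<le> i \<and> i < L) \<and> (\<Sum>i<L. w i) = 1"

lemma averaging_extend:
  assumes w: "averaging R L w" and "L \<le> L'"
  shows "(\<Sum>i<L'. w i * f i) = (\<Sum>i<L. w i * (f i :: real))"
proof (rule sum.mono_neutral_right)
  show "\<forall>i\<in>{..<L'} - {..<L}. w i * f i = 0"
    using w by (auto simp: averaging_def)
qed (use assms in auto)

lemma averaging_extend2: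
  assumes v: "averaging R L v" and w: "averaging R' L' w" and "L \<le> L''" "L' \<le> L''"
  shows "(\<Sum>i<L''. \<Sum>j<L''. v i * w j * V i j) = (\<Sum>i<L. \<Sum>j<L'. v i * w j * (V i j :: real))"
proof -
  have "(\<Sum>i<L''. \<Sum>j<L''. v i * w j * V i j) = (\<Sum>i<L''. v i * (\<Sum>j<L''. w j * V i j))"
    by (simp add: sum_distrib_left mult.assoc)
  also have "\<dots> = (\<Sum>i<L. v i * (\<Sum>j<L'. w j * V i j))"
    by (simp add: averaging_extend[OF v \<open>L \<le> L''\<close>] averaging_extend[OF w \<open>L' \<le> L''\<close>])
  finally show ?thesis by (simp add: sum_distrib_left mult.assoc)
qed

lemma averaging_le:
  assumes v: "averaging R L v" and w: "averaging R' L' w"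
    and V: "\<And>i j. R \<le> i \<Longrightarrow> i < L \<Longrightarrow> R' \<le> j \<Longrightarrow> j < L' \<Longrightarrow> V i j \<le> (c::real)"
  shows "(\<Sum>i<L. \<Sum>j<L'. v i * w j * V i j) \<le> c"
proof -
  have "(\<Sum>i<L. \<Sum>j<L'. v i * w j * V i j) \<le> (\<Sum>i<L. \<Sum>j<L'. v i * w j * c)"
  proof (intro sum_mono)
    fix i j assume ij: "i \<in> {..<L}" "j \<in> {..<L'}"
    show "v i * w j * V i j \<le> v i * w j * c"
    proof (cases "v i = 0 \<or> w j = 0")
      case False
      then have "V i j \<le> c" using v w V ij by (auto simp: averaging_def)
      then show ?thesis using v w by (intro mult_left_mono) (auto simp: averaging_def)
    qed auto
  qed
  also have "\<dots> = (\<Sum>i<L. v i) * (\<Sum>j<L'. w j) * c"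
    by (subst sum_product) (simp only: sum_distrib_right)
  also have "\<dots> = c" using v w by (simp add: averaging_def)
  finally show ?thesis .
qed

text \<open>If \<open>v\<close> and \<open>w\<close> have quadratic form at most \<open>c\<close> and mixed form at most \<open>c / 2\<close>, then \<open>(v + w) / 2\<close> has
quadratic form at most \<open>(c + c + 2 \<cdot> c / 2) / 4\<close>. The decay of \<open>V\<close> allows \<open>w\<close> to be chosen far beyond
the support of \<open>v\<close>. As hypothesis and conclusion concern every starting point \<open>R\<close>, the step can be
repeated.\<close>

lemma averaging_halving:
  fixes V :: "nat \<Rightarrow> nat \<Rightarrow> real"
  assumes sym: "\<And>i j. V i j = V j i"
    and decay: "\<And>L \<epsilon>. \<epsilon> > 0 \<Longrightarrow> \<exists>R. \<forall>i<L. \<forall>j\<ge>R. V i j \<le> \<epsilon>"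
    and c: "c > 0" and ex: "\<And>R. \<exists>L w. averaging R L w \<and> (\<Sum>i<L. \<Sum>j<L. w i * w j * V i j) \<le> c"
  shows "\<exists>L w. averaging R L w \<and> (\<Sum>i<L. \<Sum>j<L. w i * w j * V i j) \<le> 3 / 4 * c"
proof -
  obtain L v where v: "averaging R L v" and vV: "(\<Sum>i<L. \<Sum>j<L. v i * v j * V i j) \<le> c"
    using ex by blast
  obtain R0 where R0: "\<And>i j. i < L \<Longrightarrow> j \<ge> R0 \<Longrightarrow> V i j \<le> c / 2"
    using decay[of "c / 2" L] c by auto
  define R' where "R' = max R (max L R0)"
  obtain L' w where w: "averaging R' L' w" and wV: "(\<Sum>i<L'. \<Sum>j<L'. w i * w j * V i j) \<le> c"
    using ex by blast
  define M where "M = max L L'"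
  have M: "L \<le> M" "L' \<le> M" by (auto simp: M_def)
  define u where "u i = (v i + w i) / 2" for i
  have "(\<Sum>i<M. u i) = ((\<Sum>i<M. v i * 1) + (\<Sum>i<M. w i * 1)) / 2"
    by (simp add: u_def sum_divide_distrib sum.distrib add_divide_distrib)
  also have "\<dots> = 1"
    using v w unfolding averaging_extend[OF v M(1)] averaging_extend[OF w M(2)] by (simp add: averaging_def)
  finally have "sum u {..<M} = 1" .
  moreover have "0 \<le> u i" for i using v w by (simp add: averaging_def u_def)
  moreover have "R \<le> i \<and> i < M" if "u i \<noteq> 0" for i
  proof -
    have "v i \<noteq> 0 \<or> w i \<noteq> 0" using that by (auto simp: u_def)
    then show ?thesis using v w by (force simp: averaging_def M_def R'_def)
  qed
  ultimately have "averaging R M u" by (simp add: averaging_def)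
  moreover have "(\<Sum>i<M. \<Sum>j<M. u i * u j * V i j) \<le> 3 / 4 * c"
  proof -
    have "(\<Sum>i<M. \<Sum>j<M. u i * u j * V i j) =
        ((\<Sum>i<M. \<Sum>j<M. v i * v j * V i j) + (\<Sum>i<M. \<Sum>j<M. w i * w j * V i j)
          + (\<Sum>i<M. \<Sum>j<M. v i * w j * V i j) + (\<Sum>i<M. \<Sum>j<M. w i * v j * V i j)) / 4"
      unfolding sum.distrib[symmetric] sum_divide_distrib
      by (intro sum.cong refl) (simp add: u_def field_simps)
    also have "(\<Sum>i<M. \<Sum>j<M. w i * v j * V i j) = (\<Sum>i<M. \<Sum>j<M. v i * w j * V i j)"
      by (subst sum.swap) (simp add: sym mult.commute)
    also have "(\<Sum>i<M. \<Sum>j<M. v i * w j * V i j) \<le> c / 2"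
      unfolding averaging_extend2[OF v w M] by (rule averaging_le[OF v w R0]) (auto simp: R'_def)
    finally show ?thesis
      using vV wV unfolding averaging_extend2[OF v v M(1) M(1)] averaging_extend2[OF w w M(2) M(2)]
      by simp
  qed
  ultimately show ?thesis by blast
qed

lemma averaging_variance_arbitrarily_small:
  fixes V :: "nat \<Rightarrow> nat \<Rightarrow> real"
  assumes sym: "\<And>i j. V i j = V j i"
    and decay: "\<And>L \<epsilon>. \<epsilon> > 0 \<Longrightarrow> \<exists>R. \<forall>i<L. \<forall>j\<ge>R. V i j \<le> \<epsilon>"
    and ex: "\<And>R. \<exists>L w. averaging R L w \<and> (\<Sum>i<L. \<Sum>j<L. w i * w j * V i j) \<le> c"
    and "\<epsilon> > 0"
  shows "\<exists>L w. averaging R L w \<and> (\<Sum>i<L. \<Sum>j<L. w i * w j * V i j) \<le> \<epsilon>"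
proof -
  define C where "C = max c 1"
  have C: "C > 0" by (simp add: C_def)
  have "\<exists>L w. averaging R L w \<and> (\<Sum>i<L. \<Sum>j<L. w i * w j * V i j) \<le> (3 / 4)^k * C" for R k
  proof (induction k arbitrary: R)
    case 0
    then show ?case using ex[of R] by (fastforce simp: C_def)
  next
    case (Suc k)
    show ?case
      using averaging_halving[OF sym decay _ Suc, of R] C by (simp add: mult.assoc)
  qed
  moreover obtain k where "(3 / 4)^k < \<epsilon> / C"
    using real_arch_pow_inv[of "\<epsilon> / C" "3 / 4"] \<open>\<epsilon> > 0\<close> C by auto
  then have "(3 / 4)^k * C \<le> \<epsilon>" using C by (simp add: field_simps)
  ultimately show ?thesis by (meson order.trans)
qed

text \<open>Exchanging the summations, the term with index \<open>u\<close> occurs \<open>1 + j - u\<close> times.\<close>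

lemma reciprocal_double_sum:
  "(\<Sum>i=1..j. \<Sum>u=1..i. 1 / (1 + real j - real u)) = real j"
proof -
  have "(\<Sum>i=1..j. \<Sum>u=1..i. 1 / (1 + real j - real u))
      = (\<Sum>i\<in>{1..j}. \<Sum>u\<in>{u \<in> {1..j}. u \<le> i}. 1 / (1 + real j - real u))"
    by (intro sum.cong) auto
  also have "\<dots> = (\<Sum>u\<in>{1..j}. \<Sum>i\<in>{i \<in> {1..j}. u \<le> i}. 1 / (1 + real j - real u))"
    by (rule sum.swap_restrict) auto
  also have "\<dots> = (\<Sum>u\<in>{1..j}. 1)"
  proof (rule sum.cong[OF refl])
    fix u assume u: "u \<in> {1..j}"
    then have "{i \<in> {1..j}. u \<le> i} = {u..j}" by auto
    then show "(\<Sum>i\<in>{i \<in> {1..j}. u \<le> i}. 1 / (1 + real j - real u)) = 1"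
      using u by (simp add: of_nat_diff)
  qed
  finally show ?thesis by simp
qed

text \<open>Average uniformly over \<open>n \<le> i < 2 n\<close>. By \<open>reciprocal_double_sum\<close> each column of the upper triangle
contributes at most \<open>n b + 2 n c\<close>, so all \<open>n\<^sup>2\<close> entries together contribute of the order of \<open>n\<^sup>2\<close>,
although single entries may be unbounded.\<close>

lemma uniform_average_bounded:
  fixes V :: "nat \<Rightarrow> nat \<Rightarrow> real"
  assumes sym: "\<And>i j. V i j = V j i"
    and b: "b \<ge> 0" "c \<ge> 0"
    and V: "\<And>i j. R0 \<le> i \<Longrightarrow> i \<le> j \<Longrightarrow> V i j \<le> b + c * (\<Sum>u=1..i. 1 / (1 + real j - real u))"
  shows "\<exists>L w. averaging R L w \<and> (\<Sum>i<L. \<Sum>j<L. w i * w j * V i j) \<le> 2 * b + 4 * c"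
proof -
  define n where "n = Suc (max R R0)"
  define I where "I = {n..<2 * n}"
  have n: "n > 0" "card I = n" "finite I" by (auto simp: n_def I_def)
  define w where "w i = (if i \<in> I then 1 / real n else 0)" for i
  have sumw: "(\<Sum>i<2*n. w i * f i) = (\<Sum>i\<in>I. f i) / real n" for f :: "nat \<Rightarrow> real"
  proof -
    have "(\<Sum>i<2*n. w i * f i) = (\<Sum>i\<in>I. w i * f i)"
      by (rule sum.mono_neutral_right) (auto simp: w_def I_def)
    then show ?thesis by (simp add: w_def sum_divide_distrib)
  qed
  have av: "averaging R (2*n) w"
    unfolding averaging_def
  proof (intro conjI allI impI)
    show "(\<Sum>i<2*n. w i) = 1" using sumw[of "\<lambda>_. 1"] n by simp
  qed (auto simp: w_def I_def n_def split: if_splits)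
  (* The given bound on the upper triangle, extended by zero so that the full matrix is
  dominated by g and its transpose. *)
  define g where "g i j = (if i \<le> j then b + c * (\<Sum>u=1..i. 1 / (1 + real j - real u)) else 0)" for i j
  have inner: "0 \<le> (\<Sum>u=1..i. 1 / (1 + real j - real u))" if "i \<le> j" for i j
    using that by (intro sum_nonneg) auto
  have g0: "0 \<le> g i j" for i j using b inner by (auto simp: g_def)
  have Vg: "V i j \<le> g i j + g j i" if "i \<in> I" "j \<in> I" for i j
  proof (cases "i \<le> j")
    case True
    then have "V i j \<le> g i j" using V[of i j] that by (simp add: g_def I_def n_def)
    then show ?thesis using g0[of j i] by linarith
  next
    case False
    then have "V i j \<le> g j i" using V[of j i] that sym[of i j] by (simp add: g_def I_def n_def)
    then show ?thesis using g0[of i j] by linarith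
  qed
  have col: "(\<Sum>i\<in>I. g i j) \<le> real n * b + c * (2 * real n)" if "j \<in> I" for j
  proof -
    have "(\<Sum>i\<in>I. g i j) \<le> (\<Sum>i\<in>I. b + (if i \<le> j then c * (\<Sum>u=1..i. 1 / (1 + real j - real u)) else 0))"
      using b by (intro sum_mono) (auto simp: g_def)
    also have "\<dots> = real n * b + (\<Sum>i\<in>I. if i \<le> j then c * (\<Sum>u=1..i. 1 / (1 + real j - real u)) else 0)"
      using n by (simp add: sum.distrib)
    also have "(\<Sum>i\<in>I. if i \<le> j then c * (\<Sum>u=1..i. 1 / (1 + real j - real u)) else 0)
        = (\<Sum>i\<in>I \<inter> {..j}. c * (\<Sum>u=1..i. 1 / (1 + real j - real u)))"
      using n by (subst sum.inter_restrict) (auto intro!: sum.cong)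
    also have "\<dots> \<le> (\<Sum>i=1..j. c * (\<Sum>u=1..i. 1 / (1 + real j - real u)))"
      using b inner by (intro sum_mono2) (auto simp: I_def n_def)
    also have "\<dots> = c * real j" unfolding sum_distrib_left[symmetric] reciprocal_double_sum ..
    also have "\<dots> \<le> c * (2 * real n)" using b that by (intro mult_left_mono) (auto simp: I_def)
    finally show ?thesis by simp
  qed
  have "(\<Sum>i\<in>I. \<Sum>j\<in>I. V i j) \<le> (\<Sum>i\<in>I. \<Sum>j\<in>I. g i j + g j i)"
    using Vg by (intro sum_mono) auto
  also have "\<dots> = (\<Sum>i\<in>I. \<Sum>j\<in>I. g i j) + (\<Sum>i\<in>I. \<Sum>j\<in>I. g j i)" by (simp add: sum.distrib)
  also have "(\<Sum>i\<in>I. \<Sum>j\<in>I. g i j) = (\<Sum>j\<in>I. \<Sum>i\<in>I. g i j)" by (rule sum.swap)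
  also have "(\<Sum>j\<in>I. \<Sum>i\<in>I. g i j) + (\<Sum>j\<in>I. \<Sum>i\<in>I. g i j) \<le> 2 * (\<Sum>j\<in>I. real n * b + c * (2 * real n))"
    using col sum_mono[of I "\<lambda>j. \<Sum>i\<in>I. g i j" "\<lambda>_. real n * b + c * (2 * real n)"] by simp
  also have "\<dots> = (2 * b + 4 * c) * (real n * real n)"
    using n by (simp add: algebra_simps)
  finally have S: "(\<Sum>i\<in>I. \<Sum>j\<in>I. V i j) \<le> (2 * b + 4 * c) * (real n * real n)" .
  have "(\<Sum>i<2*n. \<Sum>j<2*n. w i * w j * V i j) = (\<Sum>i<2*n. w i * (\<Sum>j<2*n. w j * V i j))"
    by (simp add: sum_distrib_left mult.assoc)
  also have "\<dots> = (\<Sum>i\<in>I. \<Sum>j\<in>I. V i j) / (real n * real n)"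
    unfolding sumw by (simp add: sum_divide_distrib)
  also have "\<dots> \<le> 2 * b + 4 * c" using S n by (subst pos_divide_le_eq) auto
  finally show ?thesis using av by blast
qed

section \<open>Growth of the leakage and rigidity of the charge\<close>

text \<open>The bound \<open>O(1 / R)\<close> holds only for large \<open>R\<close>; replacing \<open>1 / R\<close> by \<open>1 / (1 + d)\<close> and enlarging the
constant by the total mass makes it uniform.\<close>

lemma tail_bound:
  fixes \<Phi> :: "real \<Rightarrow> real"
  assumes nonneg: "\<And>t. \<Phi> t \<ge> 0" and int: "integrable lborel \<Phi>"
    and tail: "(\<lambda>R. LINT t:{t. R \<le> \<bar>t\<bar>}|lborel. \<Phi> t) \<in> O[at_top](\<lambda>R. 1 / R)"
  shows "\<exists>c\<ge>0. \<forall>d::nat. (\<integral>\<^sup>+t. ennreal (\<Phi> t) * indicator {t. real d \<le> \<bar>t\<bar>} t \<partial>lborel) \<le> ennreal (c / (1 + real d))"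
proof -
  define T where "T R = (LINT t:{t. R \<le> \<bar>t\<bar>}|lborel. \<Phi> t)" for R
  have [measurable]: "\<Phi> \<in> borel_measurable borel" using borel_measurable_integrable[OF int] by simp
  have sint: "set_integrable lborel {t. R \<le> \<bar>t\<bar>} \<Phi>" for R
    using int unfolding set_integrable_def by (rule integrable_mult_indicator[rotated]) simp
  have T: "(\<integral>\<^sup>+t. ennreal (\<Phi> t) * indicator {t. R \<le> \<bar>t\<bar>} t \<partial>lborel) = ennreal (T R)" for R
  proof -
    have "(\<integral>\<^sup>+t. ennreal (\<Phi> t) * indicator {t. R \<le> \<bar>t\<bar>} t \<partial>lborel)
        = (\<integral>\<^sup>+t. ennreal (indicator {t. R \<le> \<bar>t\<bar>} t *\<^sub>R \<Phi> t) \<partial>lborel)"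
      by (intro nn_integral_cong) (auto simp: indicator_def)
    also have "\<dots> = ennreal (T R)"
      unfolding T_def set_lebesgue_integral_def
      using sint nonneg by (intro nn_integral_eq_integral) (auto simp: set_integrable_def)
    finally show ?thesis .
  qed
  have T0: "0 \<le> T R" for R
    unfolding T_def set_lebesgue_integral_def using nonneg by (intro Bochner_Integration.integral_nonneg) auto
  have Tle: "T R \<le> T 0" for R
  proof -
    have "ennreal (T R) \<le> ennreal (T 0)"
      unfolding T[symmetric] by (intro nn_integral_mono) (auto simp: indicator_def)
    then show ?thesis using T0 by (simp add: ennreal_le_iff)
  qed
  obtain C where "C > 0" and C: "\<forall>\<^sub>F R in at_top. norm (T R) \<le> C * norm (1 / R)"
    using tail unfolding T_def[symmetric] by (rule landau_o.bigE)
  then obtain R1 where R1: "\<And>R. R \<ge> R1 \<Longrightarrow> norm (T R) \<le> C * norm (1 / R)"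
    by (auto simp: eventually_at_top_linorder)
  define q where "q = max R1 1"
  define c where "c = 2 * C + T 0 * (1 + q)"
  have q: "q \<ge> 1" "q \<ge> R1" by (auto simp: q_def)
  have "c \<ge> 0" using \<open>C > 0\<close> T0[of 0] q by (simp add: c_def)
  moreover have "T (real d) \<le> c / (1 + real d)" for d :: nat
  proof (cases "real d \<ge> q")
    case True
    then have "T (real d) \<le> C / real d" using R1[of "real d"] q by simp
    also have "\<dots> \<le> 2 * C / (1 + real d)"
      using True q \<open>C > 0\<close> by (simp add: field_simps)
    also have "\<dots> \<le> c / (1 + real d)"
      using T0[of 0] q by (intro divide_right_mono) (auto simp: c_def)
    finally show ?thesis .
  next
    case False
    have "T (real d) * (1 + real d) \<le> T 0 * (1 + q)"
      using False Tle[of "real d"] T0[of "real d"] T0[of 0] by (intro mult_mono) auto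
    then have "T (real d) * (1 + real d) \<le> c" using \<open>C > 0\<close> by (simp add: c_def)
    then show ?thesis by (simp add: pos_le_divide_eq)
  qed
  ultimately show ?thesis unfolding T by (intro exI[of _ c]) (auto intro!: ennreal_leI)
qed

context projection_process
begin

text \<open>For \<open>x\<close> in the annulus \<open>u - 1 \<le> |x| \<le> u\<close> and \<open>|y| > j\<close> the distance \<open>|x - y|\<close> is at least \<open>j - u\<close>, so
the annulus leaks at most its length \<open>2\<close> times the tail of \<open>\<Phi>\<close> at \<open>j - u\<close>. Summing over the annuli
outside \<open>[-R0, R0]\<close> gives the sum of reciprocals; the bounded window itself leaks at most
\<open>\<rho>([-R0, R0] \<times> \<real>)\<close>.\<close>

lemma leakage_bound:
  assumes M: "M > 0" and \<Phi>0: "\<And>t. \<Phi> t \<ge> 0" and int: "integrable lborel \<Phi>"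
    and tail: "(\<lambda>R. LINT t:{t. R \<le> \<bar>t\<bar>}|lborel. \<Phi> t) \<in> O[at_top](\<lambda>R. 1 / R)"
    and K\<Phi>: "\<And>x y. M \<le> \<bar>x\<bar> \<Longrightarrow> M \<le> \<bar>y\<bar> \<Longrightarrow> (cmod (K x y))\<^sup>2 \<le> \<Phi> (x - y)"
  shows "\<exists>R0 b c. b \<ge> 0 \<and> c \<ge> 0 \<and>
    (\<forall>i j. R0 \<le> i \<longrightarrow> i \<le> j \<longrightarrow> leakage i j \<le> b + c * (\<Sum>u=1..i. 1 / (1 + real j - real u)))"
proof -
  have [measurable]: "\<Phi> \<in> borel_measurable borel" using borel_measurable_integrable[OF int] by simp
  obtain c where c: "c \<ge> 0" and tb: "\<And>d::nat. (\<integral>\<^sup>+t. ennreal (\<Phi> t) * indicator {t. real d \<le> \<bar>t\<bar>} t \<partial>lborel) \<le> ennreal (c / (1 + real d))"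
    using tail_bound[OF \<Phi>0 int tail] by blast
  obtain R0 :: nat where R0: "M \<le> real R0" using real_arch_simple by blast
  define A where "A u = {x. real u - 1 \<le> \<bar>x\<bar> \<and> \<bar>x\<bar> \<le> real u}" for u :: nat
  have [measurable]: "A u \<in> sets borel" for u unfolding A_def by measurable
  have annulus: "emeasure rho (A u \<times> far j) \<le> ennreal (2 * c / (1 + real j - real u))"
    if u: "R0 < u" "u \<le> j" for u j
  proof -
    have inner: "(\<integral>\<^sup>+y. ennreal ((cmod (K x y))\<^sup>2) * indicator (far j) y \<partial>lborel) \<le> ennreal (c / (1 + real (j - u)))"
      if x: "x \<in> A u" for x
    proof -
      let ?f = "\<lambda>t. ennreal (\<Phi> t) * indicator {t. real (j - u) \<le> \<bar>t\<bar>} t"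
      have "(\<integral>\<^sup>+y. ennreal ((cmod (K x y))\<^sup>2) * indicator (far j) y \<partial>lborel) \<le> (\<integral>\<^sup>+y. ?f (x + (-1) * y) \<partial>lborel)"
      proof (rule nn_integral_mono)
        fix y
        show "ennreal ((cmod (K x y))\<^sup>2) * indicator (far j) y \<le> ?f (x + (-1) * y)"
        proof (cases "y \<in> far j")
          case True
          have "M \<le> \<bar>x\<bar>" "\<bar>x\<bar> \<le> real u" using x u R0 by (auto simp: A_def)
          moreover have "M \<le> \<bar>y\<bar>" "real (j - u) \<le> \<bar>x - y\<bar>"
            using True u R0 x by (auto simp: far_def A_def of_nat_diff)
          ultimately show ?thesis using K\<Phi>[of x y] True by (auto intro: ennreal_leI)
        qed simp
      qed
      also have "\<dots> = (\<integral>\<^sup>+t. ?f t \<partial>lborel)"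
        using nn_integral_real_affine[of ?f "-1" x] by simp
      also have "\<dots> \<le> ennreal (c / (1 + real (j - u)))" by (rule tb)
      finally show ?thesis .
    qed
    have "emeasure rho (A u \<times> far j) \<le> (\<integral>\<^sup>+x. ennreal (c / (1 + real (j - u))) * indicator (A u) x \<partial>lborel)"
      using inner by (subst emeasure_kernel_measure_Times) (auto intro!: nn_integral_mono simp: indicator_def)
    also have "\<dots> = ennreal (c / (1 + real (j - u))) * emeasure lborel (A u)"
      by (rule nn_integral_cmult_indicator) simp
    also have "emeasure lborel (A u) \<le> emeasure lborel ({real u - 1..real u} \<union> {- real u..1 - real u})"
      by (intro emeasure_mono) (auto simp: A_def abs_if split: if_splits)
    also have "\<dots> \<le> emeasure lborel {real u - 1..real u} + emeasure lborel {- real u..1 - real u}"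
      by (rule emeasure_subadditive) auto
    also have "\<dots> = ennreal 2" by (simp flip: ennreal_plus)
    also have "ennreal (c / (1 + real (j - u))) * ennreal 2 = ennreal (c / (1 + real (j - u)) * 2)"
      using c by (intro ennreal_mult[symmetric]) auto
    also have "c / (1 + real (j - u)) * 2 = 2 * c / (1 + real j - real u)"
      using u by (simp add: of_nat_diff algebra_simps)
    finally show ?thesis by (simp add: mult_left_mono)
  qed
  define b where "b = measure rho ({-real R0..real R0} \<times> UNIV)"
  have "leakage i j \<le> b + (2 * c) * (\<Sum>u=1..i. 1 / (1 + real j - real u))" if ij: "R0 \<le> i" "i \<le> j" for i j
  proof -
    let ?I = "{R0 + 1..i}"
    have cover: "{-real i..real i} \<times> far j \<subseteq> {-real R0..real R0} \<times> UNIV \<union> (\<Union>u\<in>?I. A u \<times> far j)"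
    proof
      fix z assume z: "z \<in> {-real i..real i} \<times> far j"
      define u where "u = nat \<lceil>\<bar>fst z\<bar>\<rceil>"
      have u: "real u - 1 \<le> \<bar>fst z\<bar>" "\<bar>fst z\<bar> \<le> real u" unfolding u_def by linarith+
      have "\<bar>fst z\<bar> \<le> real i" using z by (auto simp: abs_le_iff)
      then have "u \<le> i" unfolding u_def by linarith
      show "z \<in> {-real R0..real R0} \<times> UNIV \<union> (\<Union>u\<in>?I. A u \<times> far j)"
      proof (cases "\<bar>fst z\<bar> \<le> real R0")
        case True
        then show ?thesis by (auto simp: mem_Times_iff abs_le_iff)
      next
        case False
        then have "u \<in> ?I" using u \<open>u \<le> i\<close> by auto
        moreover have "z \<in> A u \<times> far j" using u z by (auto simp: A_def mem_Times_iff)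
        ultimately show ?thesis by blast
      qed
    qed
    have "ennreal (leakage i j) = emeasure rho ({-real i..real i} \<times> far j)"
      unfolding leakage_def using rho_fmeasurable[of "{-real i..real i}" "far j" i]
      by (intro emeasure_eq_measure2[symmetric]) auto
    also have "\<dots> \<le> emeasure rho ({-real R0..real R0} \<times> UNIV \<union> (\<Union>u\<in>?I. A u \<times> far j))"
      by (rule emeasure_mono[OF cover]) measurable
    also have "\<dots> \<le> emeasure rho ({-real R0..real R0} \<times> UNIV) + emeasure rho (\<Union>u\<in>?I. A u \<times> far j)"
      by (rule emeasure_subadditive) measurable
    also have "\<dots> \<le> ennreal b + (\<Sum>u\<in>?I. ennreal (2 * c / (1 + real j - real u)))"
    proof (rule add_mono)
      show "emeasure rho ({-real R0..real R0} \<times> UNIV) \<le> ennreal b"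
        unfolding b_def using rho_finite[of R0] by (simp add: emeasure_eq_ennreal_measure less_top)
      have "emeasure rho (\<Union>u\<in>?I. A u \<times> far j) \<le> (\<Sum>u\<in>?I. emeasure rho (A u \<times> far j))"
        by (rule emeasure_subadditive_finite) auto
      also have "\<dots> \<le> (\<Sum>u\<in>?I. ennreal (2 * c / (1 + real j - real u)))"
        using ij by (intro sum_mono annulus) auto
      finally show "emeasure rho (\<Union>u\<in>?I. A u \<times> far j) \<le> (\<Sum>u\<in>?I. ennreal (2 * c / (1 + real j - real u)))" .
    qed
    also have "\<dots> = ennreal (b + (\<Sum>u\<in>?I. 2 * c / (1 + real j - real u)))"
      using c ij by (subst ennreal_plus) (auto simp: b_def intro!: sum_nonneg sum_ennreal)
    finally have "leakage i j \<le> b + (\<Sum>u\<in>?I. 2 * c / (1 + real j - real u))"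
      using c ij by (subst (asm) ennreal_le_iff) (auto simp: b_def intro!: add_nonneg_nonneg sum_nonneg)
    also have "(\<Sum>u\<in>?I. 2 * c / (1 + real j - real u)) \<le> (\<Sum>u=1..i. 2 * c / (1 + real j - real u))"
      using c ij by (intro sum_mono2) auto
    finally show ?thesis by (simp add: sum_distrib_left)
  qed
  then show ?thesis using c by (intro exI[of _ R0] exI[of _ b] exI[of _ "2 * c"]) (auto simp: b_def)
qed

lemma charge_integrable: "integrable P (charge i)"
  unfolding charge_def[abs_def] by (intro Bochner_Integration.integrable_diff first_moment(1)) auto

lemma charge_product_integrable: "integrable P (\<lambda>X. charge i X * charge j X)"
  using covariance_le_leakage(1)[of i j] covariance_le_leakage(1)[of j i]
  by (cases "i \<le> j") (auto simp: mult.commute)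

definition charge_cov :: "nat \<Rightarrow> nat \<Rightarrow> real" where
  "charge_cov i j = expectation (\<lambda>X. charge i X * charge j X) - expectation (charge i) * expectation (charge j)"

lemma variance_weighted:
  fixes w :: "nat \<Rightarrow> real" and L :: nat
  defines "Y \<equiv> \<lambda>X. \<Sum>i<L. w i * charge i X"
  shows "integrable P (\<lambda>X. (Y X - expectation Y)\<^sup>2)"
    and "expectation (\<lambda>X. (Y X - expectation Y)\<^sup>2) = (\<Sum>i<L. \<Sum>j<L. w i * w j * charge_cov i j)"
proof -
  let ?e = "\<lambda>i. expectation (charge i)"
  have "expectation Y = (\<Sum>i<L. expectation (\<lambda>X. w i * charge i X))"
    unfolding Y_def by (intro Bochner_Integration.integral_sum integrable_mult_right charge_integrable)
  also have "\<dots> = (\<Sum>i<L. w i * ?e i)" by simp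
  finally have EY: "expectation Y = (\<Sum>i<L. w i * ?e i)" .
  have sq: "(Y X - expectation Y)\<^sup>2 = (\<Sum>i<L. \<Sum>j<L. w i * w j * ((charge i X - ?e i) * (charge j X - ?e j)))" for X
  proof -
    have "Y X - expectation Y = (\<Sum>i<L. w i * (charge i X - ?e i))"
      unfolding EY unfolding Y_def by (simp add: sum_subtractf right_diff_distrib)
    then show ?thesis by (simp add: power2_eq_square sum_product mult_ac)
  qed
  have zz: "(charge i X - ?e i) * (charge j X - ?e j) = charge i X * charge j X - ?e j * charge i X - ?e i * charge j X + ?e i * ?e j" for i j X
    by (simp add: algebra_simps)
  have zi: "integrable P (\<lambda>X. (charge i X - ?e i) * (charge j X - ?e j))" for i j
    unfolding zz using charge_integrable charge_product_integrable by auto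
  have ze: "expectation (\<lambda>X. (charge i X - ?e i) * (charge j X - ?e j)) = charge_cov i j" for i j
    unfolding zz charge_cov_def using charge_integrable charge_product_integrable by (simp add: prob_space)
  show "integrable P (\<lambda>X. (Y X - expectation Y)\<^sup>2)"
    unfolding sq using zi by auto
  show "expectation (\<lambda>X. (Y X - expectation Y)\<^sup>2) = (\<Sum>i<L. \<Sum>j<L. w i * w j * charge_cov i j)"
    unfolding sq using zi by (simp add: Bochner_Integration.integral_sum ze)
qed

lemma small_variance:
  assumes b: "b \<ge> 0" "c \<ge> 0"
    and lb: "\<And>i j. R0 \<le> i \<Longrightarrow> i \<le> j \<Longrightarrow> leakage i j \<le> b + c * (\<Sum>u=1..i. 1 / (1 + real j - real u))"
    and "\<epsilon> > 0"
  shows "\<exists>L w. averaging R L w \<and> (\<Sum>i<L. \<Sum>j<L. w i * w j * charge_cov i j) \<le> \<epsilon>"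
proof -
  have cl: "charge_cov i j \<le> leakage i j" if "i \<le> j" for i j
    unfolding charge_cov_def by (rule covariance_le_leakage(2)[OF that])
  have sym: "charge_cov i j = charge_cov j i" for i j by (simp add: charge_cov_def mult.commute)
  show ?thesis
  proof (rule averaging_variance_arbitrarily_small[OF sym _ _ \<open>\<epsilon> > 0\<close>])
    fix L and \<delta> :: real assume "\<delta> > 0"
    then have "\<forall>\<^sub>F j in sequentially. leakage L j < \<delta>"
      using leakage_tendsto by (rule order_tendstoD(2)[rotated])
    then obtain R where R: "leakage L j < \<delta>" if "j \<ge> R" for j
      unfolding eventually_sequentially by blast
    show "\<exists>R. \<forall>i<L. \<forall>j\<ge>R. charge_cov i j \<le> \<delta>"
    proof (intro exI[of _ "max L R"] allI impI)
      fix i j assume "i < L" "j \<ge> max L R"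
      then have "charge_cov i j \<le> leakage i j" by (intro cl) auto
      also have "\<dots> \<le> leakage L j" using \<open>i < L\<close> by (intro leakage_mono) auto
      also have "\<dots> \<le> \<delta>" using R[of j] \<open>j \<ge> max L R\<close> by simp
      finally show "charge_cov i j \<le> \<delta>" .
    qed
  next
    show "\<exists>L w. averaging R L w \<and> (\<Sum>i<L. \<Sum>j<L. w i * w j * charge_cov i j) \<le> 2 * b + 4 * c" for R
      by (rule uniform_average_bounded[OF sym b, of R0]) (rule order.trans[OF cl lb])
  qed
qed

text \<open>Once the window contains \<open>B\<close>, deleting the points in \<open>B\<close> changes its charge by an amount that does
not depend on the window.\<close>

lemma charge_inside_outside:
  assumes X: "X \<in> Conf" and B: "B \<subseteq> {-real r..real r}" and "r \<le> i"
  shows "charge i X - charge i (X - B) = real (card (B \<inter> X \<inter> {0<..})) - real (card (B \<inter> X \<inter> {..<0}))"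
proof -
  have split: "count_in D X = count_in D (X - B) + real (card (B \<inter> X \<inter> D))" if "bounded D" for D
  proof -
    have "X \<inter> D = ((X - B) \<inter> D) \<union> (B \<inter> X \<inter> D)" by auto
    then have "card (X \<inter> D) = card (((X - B) \<inter> D) \<union> (B \<inter> X \<inter> D))" by (rule arg_cong)
    also have "\<dots> = card ((X - B) \<inter> D) + card (B \<inter> X \<inter> D)"
      using Conf_finite[OF X that] by (intro card_Un_disjoint) (auto elim: rev_finite_subset)
    finally show ?thesis by (simp add: count_in_def)
  qed
  have sub: "-real i \<le> x" "x \<le> real i" if "x \<in> B" for x
  proof -
    have "-real r \<le> x" "x \<le> real r" "real r \<le> real i" using B that \<open>r \<le> i\<close> by auto
    then show "-real i \<le> x" "x \<le> real i" by linarith+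
  qed
  have "B \<inter> X \<inter> pos_window i = B \<inter> X \<inter> {0<..}" "B \<inter> X \<inter> neg_window i = B \<inter> X \<inter> {..<0}"
    using sub by (auto simp: pos_window_def neg_window_def)
  then show ?thesis using split[of "pos_window i"] split[of "neg_window i"] by (simp add: charge_def)
qed

text \<open>Choose averages with variances at most \<open>2\<^sup>-\<^sup>s\<close>. The expected sum of all squared deviations is then
finite, so the deviations tend to zero almost surely. Being a limit of measurable functions of the
outside configuration, the signed count is recovered measurably; \<open>floor\<close> merely turns the real
limit, an integer almost surely, into an integer.\<close>

theorem charge_rigidity:
  assumes small: "\<And>R \<epsilon>. \<epsilon> > 0 \<Longrightarrow> \<exists>L w. averaging R L w \<and> (\<Sum>i<L. \<Sum>j<L. w i * w j * charge_cov i j) \<le> \<epsilon>"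
    and bd: "bounded B"
  shows "\<exists>N :: real set \<Rightarrow> int. N \<in> conf_space \<rightarrow>\<^sub>M count_space UNIV \<and>
    (AE X in P. int (card (B \<inter> X \<inter> {0<..})) - int (card (B \<inter> X \<inter> {..<0})) = N (X - B))"
proof -
  obtain a where a: "\<And>x. x \<in> B \<Longrightarrow> \<bar>x\<bar> \<le> a" using bd by (auto simp: bounded_iff)
  obtain r :: nat where "a \<le> real r" using real_arch_simple by blast
  then have B: "B \<subseteq> {-real r..real r}" using a by (force simp: abs_le_iff)
  have "\<forall>s. \<exists>L w. averaging r L w \<and> (\<Sum>i<L. \<Sum>j<L. w i * w j * charge_cov i j) \<le> (1/2)^s"
    by (intro allI small) simp
  from choice[OF this] obtain L where
    "\<forall>s. \<exists>w. averaging r (L s) w \<and> (\<Sum>i<L s. \<Sum>j<L s. w i * w j * charge_cov i j) \<le> (1/2)^s"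
    by (rule exE)
  from choice[OF this] obtain w where
    Lw: "\<forall>s. averaging r (L s) (w s) \<and> (\<Sum>i<L s. \<Sum>j<L s. w s i * w s j * charge_cov i j) \<le> (1/2)^s"
    by (rule exE)
  then have av: "averaging r (L s) (w s)"
    and var: "(\<Sum>i<L s. \<Sum>j<L s. w s i * w s j * charge_cov i j) \<le> (1/2)^s" for s
    by blast+
  define Y where "Y s X = (\<Sum>i<L s. w s i * charge i X)" for s :: nat and X
  define e where "e s = expectation (Y s)" for s
  have Yint: "integrable P (\<lambda>X. (Y s X - e s)\<^sup>2)" and Yvar: "expectation (\<lambda>X. (Y s X - e s)\<^sup>2) \<le> (1/2)^s" for s
    using variance_weighted[where L="L s" and w="w s"] var[of s] unfolding e_def Y_def by auto
  have Zm: "charge i \<in> borel_measurable conf_space" for i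
    unfolding charge_def[abs_def] by (intro borel_measurable_diff count_in_measurable) auto
  have Ym [measurable]: "Y s \<in> borel_measurable conf_space" for s
    unfolding Y_def[abs_def] using Zm by measurable
  have YmP [measurable]: "Y s \<in> borel_measurable P" for s
    using Ym by (simp cong: measurable_cong_sets add: sets_P)
  have "(\<integral>\<^sup>+X. (\<Sum>s. ennreal ((Y s X - e s)\<^sup>2)) \<partial>P) = (\<Sum>s. \<integral>\<^sup>+X. ennreal ((Y s X - e s)\<^sup>2) \<partial>P)"
    by (rule nn_integral_suminf) simp
  also have "\<dots> = (\<Sum>s. ennreal (expectation (\<lambda>X. (Y s X - e s)\<^sup>2)))"
    by (simp add: nn_integral_eq_integral[OF Yint])
  also have "\<dots> \<le> (\<Sum>s. ennreal ((1/2)^s))"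
    by (intro suminf_le ennreal_leI Yvar) simp_all
  also have "\<dots> < \<infinity>" by (subst suminf_ennreal2) (simp_all add: summable_geometric)
  finally have "(\<integral>\<^sup>+X. (\<Sum>s. ennreal ((Y s X - e s)\<^sup>2)) \<partial>P) \<noteq> \<infinity>" by simp
  then have "AE X in P. (\<Sum>s. ennreal ((Y s X - e s)\<^sup>2)) \<noteq> \<infinity>"
    by (rule nn_integral_PInf_AE[rotated]) simp
  then have conv: "AE X in P. (\<lambda>s. Y s X - e s) \<longlonglongrightarrow> 0"
  proof eventually_elim
    case (elim X)
    then have "summable (\<lambda>s. (Y s X - e s)\<^sup>2)"
      unfolding infinity_ennreal_def by (intro summable_suminf_not_top) auto
    then have "(\<lambda>s. (Y s X - e s)\<^sup>2) \<longlonglongrightarrow> 0" by (rule summable_LIMSEQ_zero)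
    then have "(\<lambda>s. sqrt ((Y s X - e s)\<^sup>2)) \<longlonglongrightarrow> sqrt 0" by (rule tendsto_real_sqrt)
    then show ?case by (simp add: tendsto_rabs_zero_iff)
  qed
  define N where "N X = \<lfloor>lim (\<lambda>s. e s - Y s X)\<rfloor>" for X
  have "N \<in> conf_space \<rightarrow>\<^sub>M count_space UNIV"
    unfolding N_def[abs_def] by measurable
  moreover have "AE X in P. int (card (B \<inter> X \<inter> {0<..})) - int (card (B \<inter> X \<inter> {..<0})) = N (X - B)"
    using conv AE_space
  proof eventually_elim
    case (elim X)
    then have X: "X \<in> Conf" by (simp add: space_P)
    define q where "q = int (card (B \<inter> X \<inter> {0<..})) - int (card (B \<inter> X \<inter> {..<0}))"
    have eq: "e s - Y s (X - B) = real_of_int q - (Y s X - e s)" for s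
    proof -
      have "Y s X - Y s (X - B) = (\<Sum>i<L s. w s i * (charge i X - charge i (X - B)))"
        by (simp add: Y_def right_diff_distrib sum_subtractf)
      also have "\<dots> = (\<Sum>i<L s. w s i * real_of_int q)"
      proof (rule sum.cong[OF refl])
        fix i
        show "w s i * (charge i X - charge i (X - B)) = w s i * real_of_int q"
        proof (cases "w s i = 0")
          case False
          then have "r \<le> i" using av[of s] by (auto simp: averaging_def)
          then show ?thesis using charge_inside_outside[OF X B] by (simp add: q_def)
        qed simp
      qed
      also have "\<dots> = real_of_int q"
        using av[of s] by (simp add: averaging_def flip: sum_distrib_right)
      finally show ?thesis by simp
    qed
    have "(\<lambda>s. real_of_int q - (Y s X - e s)) \<longlonglongrightarrow> real_of_int q - 0"
      by (intro tendsto_intros elim)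
    then have "(\<lambda>s. e s - Y s (X - B)) \<longlonglongrightarrow> real_of_int q" unfolding eq by simp
    then have "lim (\<lambda>s. e s - Y s (X - B)) = real_of_int q" by (rule limI)
    then have "N (X - B) = q" by (simp add: N_def)
    then show ?case by (simp add: q_def)
  qed
  ultimately show ?thesis by blast
qed

end

theorem theorem1p4:
  fixes K :: "real \<Rightarrow> real \<Rightarrow> complex" and T :: L2_operator
    and M :: real and P :: "real set measure" and B :: "real set"
  assumes "J_hermitian K"
    and "integral_kernel K T"
    and "diagonal_gives_local_traces K T"
    and "L2_nonneg (compress {0<..} T {0<..})"
    and "L2_nonneg (compress {..<0} T {..<0})"
    and "\<forall>\<Delta>1 \<Delta>2. \<Delta>1 \<in> sets borel \<and> bounded \<Delta>1 \<and> \<Delta>1 \<subseteq> {0<..} \<and>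
           \<Delta>2 \<in> sets borel \<and> bounded \<Delta>2 \<and> \<Delta>2 \<subseteq> {..<0} \<longrightarrow>
           L2_trace_class (compress \<Delta>1 T \<Delta>1) \<and> L2_trace_class (compress \<Delta>2 T \<Delta>2) \<and>
           L2_hilbert_schmidt (compress \<Delta>2 T \<Delta>1)"
    and "L2_orthogonal_projection (hat_op T)"
    and "\<forall>R>0. set_integrable lborel {x. \<bar>x\<bar> \<le> R} (\<lambda>x. K x x)"
    and "M > 0"
    and "\<exists>\<Phi> :: real \<Rightarrow> real. (\<forall>t. \<Phi> t \<ge> 0) \<and> integrable lborel \<Phi> \<and>
           (\<lambda>R. LINT t:{t. R \<le> \<bar>t\<bar>}|lborel. \<Phi> t) \<in> O[at_top](\<lambda>R. 1 / R) \<and>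
           (\<forall>x y. M \<le> \<bar>x\<bar> \<and> M \<le> \<bar>y\<bar> \<longrightarrow> (cmod (K x y))\<^sup>2 \<le> \<Phi> (x - y))"
    and "determinantal K P"
    and "B \<in> sets borel" and "bounded B"
  shows "\<exists>N :: real set \<Rightarrow> int. N \<in> conf_space \<rightarrow>\<^sub>M count_space UNIV \<and>
           (AE X in P. int (card (B \<inter> X \<inter> {0<..})) - int (card (B \<inter> X \<inter> {..<0})) = N (X - B))"
proof -
  have K: "case_prod K \<in> borel_measurable (lborel \<Otimes>\<^sub>M lborel)"
    by (rule integral_kernel_measurable[OF assms(2)])
  (* Every instance of the trace-class condition provides an orthonormal basis; the empty sets give
  one. *)
  have "L2_trace_class (compress {} T {})" using assms(6)[rule_format, of "{}" "{}"] by simp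
  then obtain e where e: "L2_orthonormal_basis e" unfolding L2_trace_class_def by blast
  interpret hermitian_process K P by standard (fact K assms(1) assms(11))+
  interpret projection_process K P
  proof
    fix D s assume D: "bounded D" "D \<in> sets borel" and half: "half_line s D"
    have "s = 1 \<or> s = -1" using half by (auto simp: half_line_def)
    then have "D \<subseteq> {0<..} \<or> D \<subseteq> {..<0}"
      using half by (force simp: half_line_def sgn_1_pos sgn_1_neg)
    then have "emeasure rho (D \<times> UNIV) = ennreal (Re (LINT x:D|lborel. K x x))"
      using trace_eq_kernel_measure[OF assms(2,1,3,7) e D(2,1) _ rho_finite_bounded[OF D half]] by blast
    then show "emeasure rho (D \<times> UNIV) = ennreal (mean_count D)" by (simp add: first_moment(3)[OF D])
  qed
  obtain \<Phi> where \<Phi>: "\<And>t. \<Phi> t \<ge> (0 :: real)" "integrable lborel \<Phi>"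
      "(\<lambda>R. LINT t:{t. R \<le> \<bar>t\<bar>}|lborel. \<Phi> t) \<in> O[at_top](\<lambda>R. 1 / R)"
    and K\<Phi>: "\<And>x y. M \<le> \<bar>x\<bar> \<Longrightarrow> M \<le> \<bar>y\<bar> \<Longrightarrow> (cmod (K x y))\<^sup>2 \<le> \<Phi> (x - y)"
    using assms(10) by blast
  from leakage_bound[OF assms(9) \<Phi> K\<Phi>] obtain R0 b c where bc: "b \<ge> 0" "c \<ge> 0"
    and lb: "\<And>i j. R0 \<le> i \<Longrightarrow> i \<le> j \<Longrightarrow> leakage i j \<le> b + c * (\<Sum>u=1..i. 1 / (1 + real j - real u))"
    by blast
  show ?thesis by (rule charge_rigidity[OF small_variance[OF bc lb] assms(13)])
qed

end
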